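(* Let $X=X(Q_0)$ be a rearrangement invariant space with Boyd indices in $(0,1)$. Then $GaRo_X=X$ as sets. Moreover, for all $f\in X$, \[ \|f-f_{Q_0}\|_{GaRo_X}\le 2\|f\|_X, \] and there is a constant $c(X)$ depending only on $X$ such that for all $f\in GaRo_X$, \[ \|f-f_{Q_0}\|_X\le c(X)\|f\|_{GaRo_X}. \]
   Context: $Q_0=(0,1)^n$ with Lebesgue measure; cubes are subcubes of $Q_0$ with sides parallel to the axes, $f_Q=\frac1{|Q|}\int_Qf$. $P$ is the set of countable families $\{Q_i\}_{i\in I}$ of subcubes of $Q_0$ with pairwise disjoint interiors. $f^*$ is the decreasing rearrangement of $f$ on $[0,1)$ and $f^{**}(t)=\frac1t\int_0^tf^*(s)\,ds$. A rearrangement invariant (r.i.) space $X$ is a Banach function space on $Q_0$ such that $f^*=g^*$, $g\in X$ imply $f\in X$ and $\|f\|_X=\|g\|_X$; its norm is also viewed as a norm on functions on $(0,1)$ via $\|f\|_X=\|f^*\|_X$. "$X$ has Boyd indices in $(0,1)$" means there are constants $\beta_0(X),\beta_1(X)$ with $\|f^{**}\|_X\le\beta_0(X)\|f\|_X$ and $\|t\mapsto\int_t^1 f^*(s)\frac{ds}{s}\|_X\le\beta_1(X)\|f\|_X$ for all $f\in X$. An integrable $f$ belongs to $GaRo_X$ if there is $\gamma\in X$ such that for all $\{Q_i\}_{i\in I}\in P$, $\sum_{i}\frac1{|Q_i|}\int_{Q_i}\int_{Q_i}|f(x)-f(y)|\,dx\,dy\le\sum_i\int_{Q_i}\gamma$;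 $\Gamma_f^X$ is the set of such $\gamma\in X$ and $\|f\|_{GaRo_X}=\inf\{\|\gamma\|_X:\gamma\in\Gamma_f^X\}$. *)

theory Defs
  imports "HOL-Analysis.Analysis"
begin

definition Q0 :: "(real^'n) set" where
  "Q0 = box 0 One"

text \<open>A cube: an (open) axis-parallel subcube of Q0. Since only integrals and
  measures of cubes matter, open cubes are used; then "disjoint interiors" is just disjointness.\<close>
definition is_cube :: "(real^'n) set \<Rightarrow> bool" where
  "is_cube Q \<longleftrightarrow> (\<exists>a h. h > 0 \<and> Q = box a (a + h *\<^sub>R One)) \<and> Q \<subseteq> Q0"

definition cube_families :: "(real^'n) set set set" where
  "cube_families = {F. countable F \<and> (\<forall>Q\<in>F. is_cube Q) \<and>
                        (\<forall>Q\<in>F. \<forall>Q'\<in>F. Q \<noteq> Q' \<longrightarrow> Q \<inter> Q' = {})}"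

definition avg :: "(real^'n) set \<Rightarrow> (real^'n \<Rightarrow> real) \<Rightarrow> real" where
  "avg Q f = (1 / measure lebesgue Q) * (LINT x:Q|lebesgue. f x)"

definition distf :: "(real^'n \<Rightarrow> real) \<Rightarrow> real \<Rightarrow> real" where
  "distf f s = measure lebesgue {x\<in>Q0. \<bar>f x\<bar> > s}"

definition rearr :: "(real^'n \<Rightarrow> real) \<Rightarrow> real \<Rightarrow> real" where
  "rearr f t = Inf {s. 0 \<le> s \<and> distf f s \<le> t}"

definition rearr2 :: "(real^'n \<Rightarrow> real) \<Rightarrow> real \<Rightarrow> real" where
  "rearr2 f t = (1 / t) * (LINT s:{0<..<t}|lborel. rearr f s)"

definition nnmeas :: "(real^'n \<Rightarrow> real) \<Rightarrow> bool" where
  "nnmeas f \<longleftrightarrow> f \<in> borel_measurable (lebesgue_on Q0) \<and> (\<forall>x\<in>Q0. 0 \<le> f x)"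

text \<open>Banach function norm (Bennett--Sharpley, properties P1--P5) on nonnegative
  measurable functions on Q0, with values in [0,\<infinity>].\<close>
definition bf_norm :: "((real^'n \<Rightarrow> real) \<Rightarrow> ennreal) \<Rightarrow> bool" where
  "bf_norm \<rho> \<longleftrightarrow>
    (\<forall>f. nnmeas f \<longrightarrow> (\<rho> f = 0 \<longleftrightarrow> (AE x in lebesgue_on Q0. f x = 0))) \<and>
    (\<forall>f a. nnmeas f \<and> 0 \<le> a \<longrightarrow> \<rho> (\<lambda>x. a * f x) = ennreal a * \<rho> f) \<and>
    (\<forall>f g. nnmeas f \<and> nnmeas g \<longrightarrow> \<rho> (\<lambda>x. f x + g x) \<le> \<rho> f + \<rho> g) \<and>
    (\<forall>f g. nnmeas f \<and> nnmeas g \<and> (AE x in lebesgue_on Q0. g x \<le> f x) \<longrightarrow> \<rho> g \<le> \<rho> f) \<and>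
    (\<forall>F f. (\<forall>k. nnmeas (F k)) \<and> nnmeas f \<and>
        (\<forall>k. AE x in lebesgue_on Q0. F k x \<le> F (Suc k) x) \<and>
        (AE x in lebesgue_on Q0. (\<lambda>k. F k x) \<longlonglongrightarrow> f x)
        \<longrightarrow> (SUP k. \<rho> (F k)) = \<rho> f) \<and>
    (\<forall>E. E \<in> sets lebesgue \<and> E \<subseteq> Q0 \<longrightarrow> \<rho> (indicator E) < \<infinity>) \<and>
    (\<forall>E. E \<in> sets lebesgue \<and> E \<subseteq> Q0 \<longrightarrow>
        (\<exists>C::real. \<forall>f. nnmeas f \<longrightarrow> (\<integral>\<^sup>+x\<in>E. ennreal (f x) \<partial>lebesgue) \<le> ennreal C * \<rho> f))"

definition ri_space :: "((real^'n \<Rightarrow> real) \<Rightarrow> ennreal) \<Rightarrow> bool" where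
  "ri_space \<rho> \<longleftrightarrow> bf_norm \<rho> \<and>
    (\<forall>f g. nnmeas f \<and> nnmeas g \<and> (\<forall>t\<in>{0<..<1}. rearr f t = rearr g t) \<longrightarrow> \<rho> f = \<rho> g)"

definition Xsp :: "((real^'n \<Rightarrow> real) \<Rightarrow> ennreal) \<Rightarrow> (real^'n \<Rightarrow> real) set" where
  "Xsp \<rho> = {f. f \<in> borel_measurable (lebesgue_on Q0) \<and> \<rho> (\<lambda>x. \<bar>f x\<bar>) < \<infinity>}"

definition xnorm :: "((real^'n \<Rightarrow> real) \<Rightarrow> ennreal) \<Rightarrow> (real^'n \<Rightarrow> real) \<Rightarrow> real" where
  "xnorm \<rho> f = enn2real (\<rho> (\<lambda>x. \<bar>f x\<bar>))"

text \<open>The X-(quasi)norm of a function g on (0,1): the norm of an equimeasurable function on Q0,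
  namely x \<mapsto> g (x$i) for a fixed coordinate i (well defined by rearrangement invariance).\<close>
definition lift01 :: "(real \<Rightarrow> real) \<Rightarrow> real^'n \<Rightarrow> real" where
  "lift01 g = (\<lambda>x. g (x $ (SOME i. True)))"

definition boyd_in_01 :: "((real^'n \<Rightarrow> real) \<Rightarrow> ennreal) \<Rightarrow> bool" where
  "boyd_in_01 \<rho> \<longleftrightarrow> (\<exists>\<beta>0 \<beta>1::real.
     \<forall>f\<in>Xsp \<rho>.
       \<rho> (lift01 (\<lambda>t. \<bar>rearr2 f t\<bar>)) \<le> ennreal \<beta>0 * \<rho> (\<lambda>x. \<bar>f x\<bar>) \<and>
       \<rho> (lift01 (\<lambda>t. \<bar>LINT s:{t<..<1}|lborel. rearr f s / s\<bar>)) \<le> ennreal \<beta>1 * \<rho> (\<lambda>x. \<bar>f x\<bar>))"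

definition osc_term :: "(real^'n \<Rightarrow> real) \<Rightarrow> (real^'n) set \<Rightarrow> real" where
  "osc_term f Q = (1 / measure lebesgue Q) *
     (LINT x:Q|lebesgue. (LINT y:Q|lebesgue. \<bar>f x - f y\<bar>))"

definition Gamma :: "((real^'n \<Rightarrow> real) \<Rightarrow> ennreal) \<Rightarrow> (real^'n \<Rightarrow> real) \<Rightarrow> (real^'n \<Rightarrow> real) set" where
  "Gamma \<rho> f = {\<gamma>\<in>Xsp \<rho>. \<forall>F\<in>cube_families.
       (\<lambda>Q. osc_term f Q) summable_on F \<and>
       (\<Sum>\<^sub>\<infinity>Q\<in>F. osc_term f Q) \<le> (\<Sum>\<^sub>\<infinity>Q\<in>F. LINT x:Q|lebesgue. \<gamma> x)}"

definition GaRo :: "((real^'n \<Rightarrow> real) \<Rightarrow> ennreal) \<Rightarrow> (real^'n \<Rightarrow> real) set" where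
  "GaRo \<rho> = {f. integrable (lebesgue_on Q0) f \<and> Gamma \<rho> f \<noteq> {}}"

definition garo_norm :: "((real^'n \<Rightarrow> real) \<Rightarrow> ennreal) \<Rightarrow> (real^'n \<Rightarrow> real) \<Rightarrow> real" where
  "garo_norm \<rho> f = (INF \<gamma>\<in>Gamma \<rho> f. xnorm \<rho> \<gamma>)"

end

(* The inclusion of X in GaRo_X holds with gamma = 2|f|. Conversely, let gamma be admissible for f and
   put h = f - avg. A Calderon-Zygmund covering of the level set of height h*(2t) by cubes of which
   at least half lies outside it gives h*(t) <= h*(2t) + 4C gamma**(2Ct) for small t, C = 2^(n+2).
   Iterating over the dyadic scales yields h*(t) <= 2C |h|_1 + 8C int_t^1 g*(s) ds/s, where g is a
   function on Q0 equimeasurable with gamma**. The two Boyd conditions bound the norm of the integral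
   by that of gamma, and |h|_1 <= osc(f, Q0) <= int gamma. *)
theory Submission
  imports Defs
begin

section \<open>Distribution functions and rearrangements\<close>

text \<open>Admissibility of gamma bounds only sums of oscillations over disjoint cubes, and an
  oscillation is informative only on a cube that sees both large and small values of h. This is why
  the level set may fill at most half of each selected cube: the other half supplies the values, at
  most h*(2t), against which the large ones are measured. The cubes may sit anywhere, so the
  integral of gamma over their union is controlled by their total measure alone. That is what brings
  in gamma**, and with it the first Boyd condition. Summing over scales uses the second condition,
  which speaks only of rearrangements of functions in X on the cube; hence gamma** is carried back
  to Q0 as g before the summation. The covering exists only while the level set is small compared
  with Q0. At the largest admissible t the L1 norm of h takes over, and the oscillation on Q0 bounds
  it because the average has been subtracted. The resulting inequality is between values in
  [0, infinity], so that it yields membership in X together with the norm estimate.\<close>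

lemma One_nth: "(One :: real^'n) $ i = 1"
  by (simp add: cart_eq_inner_axis inner_sum_left_Basis axis_in_Basis_iff)

lemma mem_Q0: "x \<in> Q0 \<longleftrightarrow> (\<forall>i. 0 < x $ i \<and> x $ i < 1)"
  by (auto simp: Q0_def mem_box_cart One_nth simp del: sum_component)

lemma open_Q0: "open Q0"
  by (simp add: Q0_def open_box)

lemma Q0_lmeasurable [simp, intro]: "(Q0 :: (real^'n) set) \<in> lmeasurable"
  by (simp add: Q0_def)

lemma Q0_sets [simp, intro]: "(Q0 :: (real^'n) set) \<in> sets lebesgue"
  by (simp add: fmeasurableD)

lemma measure_cube:
  fixes a :: "real^'n"
  assumes "h \<ge> 0"
  shows "measure lebesgue (box a (a + h *\<^sub>R One)) = h ^ CARD('n)"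
  using assms by (simp add: measure_lborel_box_eq inner_simps inner_sum_left_Basis)

lemma measure_Q0: "measure lebesgue (Q0 :: (real^'n) set) = 1"
  using measure_cube[of 1 "0::real^'n"] by (simp add: Q0_def)

text \<open>A coordinate is uniformly distributed on \<open>Q0\<close>. This makes a function on
  (0,1) and its \<open>lift01\<close> equimeasurable.\<close>

lemma measure_coordinate_slab:
  fixes i :: "'n::finite"
  assumes "0 \<le> a" "a \<le> 1"
  shows "measure lebesgue {x \<in> (Q0 :: (real^'n) set). x $ i < a} = a"
proof -
  have eq: "{x \<in> (Q0 :: (real^'n) set). x $ i < a} = box 0 (\<chi> j. if j = i then a else 1)"
    using assms by (auto simp: mem_Q0 mem_box_cart split: if_splits) (metis order.strict_trans2)+
  have "measure lborel (box 0 (\<chi> j. if j = i then a else 1) :: (real^'n) set)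
      = (\<Prod>b\<in>Basis. (\<chi> j. if j = i then a else 1) \<bullet> (b::real^'n))"
    using assms by (subst measure_lborel_box_eq) (auto simp: Basis_vec_def inner_axis)
  also have "\<dots> = (\<Prod>j\<in>UNIV. if j = i then a else 1)"
    by (simp add: Basis_vec_def inner_axis axis_eq_axis prod.UNION_disjoint)
  also have "\<dots> = a" by simp
  finally show ?thesis by (simp add: eq)
qed

lemma superlevel_sets:
  fixes f :: "real^'n \<Rightarrow> real"
  assumes "f \<in> borel_measurable (lebesgue_on Q0)"
  shows "{x \<in> Q0. \<bar>f x\<bar> > s} \<in> lmeasurable"
proof -
  have "{x \<in> space (lebesgue_on Q0). \<bar>f x\<bar> > s} \<in> sets (lebesgue_on Q0)"
    using borel_measurable_abs[OF assms] by (simp only: borel_measurable_iff_greater)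
  then have "{x \<in> Q0. \<bar>f x\<bar> > s} \<in> sets lebesgue"
    by (simp add: sets_restrict_space_iff)
  then show ?thesis
    by (rule fmeasurableI2[OF Q0_lmeasurable, rotated]) auto
qed

lemma distf_antimono:
  assumes "f \<in> borel_measurable (lebesgue_on Q0)" "s \<le> s'"
  shows "distf f s' \<le> distf f s"
  unfolding distf_def using assms
  by (intro measure_mono_fmeasurable superlevel_sets fmeasurableD) auto

lemma distf_le_1:
  assumes "f \<in> borel_measurable (lebesgue_on Q0)"
  shows "distf (f :: real^'n \<Rightarrow> real) s \<le> 1"
  unfolding distf_def measure_Q0[where 'n='n, symmetric] using assms
  by (intro measure_mono_fmeasurable superlevel_sets fmeasurableD) auto

lemma distf_nonneg: "distf f s \<ge> 0"
  by (simp add: distf_def)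

lemma distf_tendsto_0:
  assumes f: "f \<in> borel_measurable (lebesgue_on Q0)"
  shows "(\<lambda>k. distf f (real k)) \<longlonglongrightarrow> 0"
proof -
  have "(\<lambda>k. measure lebesgue {x \<in> Q0. \<bar>f x\<bar> > real k}) \<longlonglongrightarrow>
      measure lebesgue (\<Inter>k. {x \<in> Q0. \<bar>f x\<bar> > real k})"
    using superlevel_sets[OF f] fmeasurableD2[OF superlevel_sets[OF f]]
    by (intro Lim_measure_decseq) (auto simp: decseq_def fmeasurableD image_subset_iff simp del: emeasure_completion)
  moreover have "(\<Inter>k. {x \<in> Q0. \<bar>f x\<bar> > real k}) = {}"
    by (auto simp: not_less) (meson real_arch_simple not_le)
  ultimately show ?thesis by (simp add: distf_def)
qed

text \<open>Right continuity of \<open>distf f\<close>, from continuity of the measure along the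
  sets where |f| exceeds s + 1/(k+1), which increase to the set where |f| exceeds s. It is what
  makes the equivalence in \<open>less_rearr_iff\<close> exact.\<close>

lemma distf_right_open:
  assumes f: "f \<in> borel_measurable (lebesgue_on Q0)" and "t < distf f s"
  obtains s' where "s < s'" "t < distf f s'"
proof -
  have "(\<lambda>k. measure lebesgue {x \<in> Q0. \<bar>f x\<bar> > s + 1 / real (Suc k)}) \<longlonglongrightarrow>
      measure lebesgue (\<Union>k. {x \<in> Q0. \<bar>f x\<bar> > s + 1 / real (Suc k)})"
  proof (intro Lim_measure_incseq)
    show "incseq (\<lambda>k. {x \<in> Q0. s + 1 / real (Suc k) < \<bar>f x\<bar>})"
    proof (rule incseq_SucI)
      fix k
      have "1 / real (Suc (Suc k)) \<le> 1 / real (Suc k)" by (simp add: field_simps)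
      then show "{x \<in> Q0. s + 1 / real (Suc k) < \<bar>f x\<bar>}
          \<subseteq> {x \<in> Q0. s + 1 / real (Suc (Suc k)) < \<bar>f x\<bar>}"
        by (auto simp del: of_nat_Suc)
    qed
    have "(\<Union>k. {x \<in> Q0. s + 1 / real (Suc k) < \<bar>f x\<bar>}) \<in> lmeasurable"
      using superlevel_sets[OF f]
      by (intro fmeasurableI2[OF Q0_lmeasurable]) (auto intro!: sets.countable_UN fmeasurableD)
    then show "emeasure lebesgue (\<Union>k. {x \<in> Q0. s + 1 / real (Suc k) < \<bar>f x\<bar>}) \<noteq> \<infinity>"
      unfolding infinity_ennreal_def by (rule fmeasurableD2)
  qed (use superlevel_sets[OF f] in \<open>auto simp: fmeasurableD\<close>)
  moreover have "(\<Union>k. {x \<in> Q0. \<bar>f x\<bar> > s + 1 / real (Suc k)}) = {x \<in> Q0. \<bar>f x\<bar> > s}"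
  proof -
    have "\<exists>k. s + 1 / real (Suc k) < u" if "s < u" for u
      using reals_Archimedean[of "u - s"] that by (auto simp: inverse_eq_divide less_diff_eq add.commute)
    moreover have "s < u" if "s + 1 / real (Suc k) < u" for u k
    proof -
      have "1 / real (Suc k) > 0" by simp
      then show ?thesis using that by linarith
    qed
    ultimately show ?thesis by (auto simp del: of_nat_Suc)
  qed
  ultimately have "(\<lambda>k. distf f (s + 1 / real (Suc k))) \<longlonglongrightarrow> distf f s"
    by (simp add: distf_def)
  then have "eventually (\<lambda>k. t < distf f (s + 1 / real (Suc k))) sequentially"
    using assms(2) order_tendstoD(1) by blast
  then obtain k where "t < distf f (s + 1 / real (Suc k))"
    by (auto simp: eventually_sequentially)
  then show ?thesis by (intro that[of "s + 1 / real (Suc k)"]) auto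
qed

text \<open>The Galois-type link between the two monotone functions; the order properties of
  \<open>rearr\<close> are read off from it. For t > 0 the set under the infimum is nonempty because
  \<open>distf f\<close> tends to 0; at t = 0 an essentially unbounded f would leave the infimum of
  the empty set.\<close>

lemma less_rearr_iff:
  assumes f: "f \<in> borel_measurable (lebesgue_on Q0)" and t: "0 < t" and s: "0 \<le> s"
  shows "s < rearr f t \<longleftrightarrow> t < distf f s"
proof -
  let ?S = "{s. 0 \<le> s \<and> distf f s \<le> t}"
  have bdd: "bdd_below ?S" by (auto intro!: bdd_belowI[of _ 0])
  obtain k where "distf f (real k) < t"
    using order_tendstoD(2)[OF distf_tendsto_0[OF f] t] by (auto simp: eventually_sequentially)
  then have ne: "?S \<noteq> {}" by (auto intro!: exI[of _ "real k"])
  show ?thesis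
  proof
    assume "s < rearr f t"
    then have "s \<notin> ?S" using cInf_lower[OF _ bdd] by (fastforce simp: rearr_def)
    then show "t < distf f s" using s by auto
  next
    assume "t < distf f s"
    then obtain s' where s': "s < s'" "t < distf f s'" using distf_right_open[OF f] by blast
    have "s' \<le> Inf ?S"
    proof (rule cInf_greatest[OF ne])
      fix u assume u: "u \<in> ?S"
      show "s' \<le> u"
        using distf_antimono[OF f, of u s'] u s' by fastforce
    qed
    then show "s < rearr f t" using s' by (simp add: rearr_def)
  qed
qed

lemma rearr_nonneg:
  assumes f: "f \<in> borel_measurable (lebesgue_on Q0)" and t: "0 < t"
  shows "0 \<le> rearr f t"
proof -
  obtain k where "distf f (real k) < t"
    using order_tendstoD(2)[OF distf_tendsto_0[OF f] t] by (auto simp: eventually_sequentially)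
  then have ne: "{s. 0 \<le> s \<and> distf f s \<le> t} \<noteq> {}" by (auto intro!: exI[of _ "real k"])
  then show ?thesis unfolding rearr_def by (rule cInf_greatest) auto
qed

lemma rearr_antimono:
  assumes f: "f \<in> borel_measurable (lebesgue_on Q0)" and t: "0 < t" "t \<le> u"
  shows "rearr f u \<le> rearr f t"
proof (rule ccontr)
  assume *: "\<not> ?thesis"
  have "t \<ge> distf f (rearr f t)"
    using less_rearr_iff[OF f t(1) rearr_nonneg[OF f t(1)]] by simp
  moreover have "u < distf f (rearr f t)"
    using less_rearr_iff[of f u "rearr f t"] f t * rearr_nonneg[OF f t(1)] by auto
  ultimately show False using t by linarith
qed

lemma distf_rearr_le:
  assumes f: "f \<in> borel_measurable (lebesgue_on Q0)" and t: "0 < t"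
  shows "distf f (rearr f t) \<le> t"
  using less_rearr_iff[OF f t rearr_nonneg[OF f t]] by simp

lemma rearr_superlevel:
  assumes f: "f \<in> borel_measurable (lebesgue_on Q0)" and s: "0 \<le> s"
  shows "{t \<in> {0<..<1}. s < rearr f t} = {0<..<distf f s}"
  using less_rearr_iff[OF f _ s] distf_le_1[OF f, of s] by auto

section \<open>The rearrangement as a measurable function on (0,1) and its law\<close>

lemma borel_measurable_antimono:
  fixes \<phi> :: "real \<Rightarrow> real"
  assumes "\<And>s t. 0 < s \<Longrightarrow> s \<le> t \<Longrightarrow> t < 1 \<Longrightarrow> \<phi> t \<le> \<phi> s"
  shows "\<phi> \<in> borel_measurable (restrict_space lborel {0<..<1})"
proof -
  have "(\<lambda>t. - \<phi> t) \<in> borel_measurable (restrict_space borel {0<..<1})"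
    by (rule borel_measurable_mono_on_fnc) (auto intro!: mono_onI assms)
  then have "\<phi> \<in> borel_measurable (restrict_space borel {0<..<1})"
    using borel_measurable_uminus by fastforce
  then show ?thesis
    by (subst measurable_cong_sets[OF sets_restrict_space_cong[OF sets_lborel] refl])
qed

lemma rearr_borel:
  assumes "f \<in> borel_measurable (lebesgue_on Q0)"
  shows "rearr f \<in> borel_measurable (restrict_space lborel {0<..<1})"
  by (intro borel_measurable_antimono rearr_antimono[OF assms])

text \<open>Equimeasurability as equality of image measures, so that integrability and integrals of
  any Borel function of |f| transfer by change of variables. Half-lines determine the measures; for
  negative s both sides are the total mass 1, and \<open>rearr_superlevel\<close> covers the
  rest.\<close>

lemma distr_rearr:
  assumes f: "f \<in> borel_measurable (lebesgue_on Q0)"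
  shows "distr (lebesgue_on Q0) borel (\<lambda>x::real^'n. \<bar>f x\<bar>) =
    distr (restrict_space lborel {0<..<1}) borel (rearr f)"
    (is "?M = ?N")
proof (rule measure_eqI_lessThan)
  have em: "emeasure ?M {s<..} = ennreal (distf f s)" for s
  proof -
    have "emeasure ?M {s<..} = emeasure (lebesgue_on Q0) ({x. \<bar>f x\<bar> > s} \<inter> Q0)"
      using f by (subst emeasure_distr) (auto simp: vimage_def)
    also have "\<dots> = emeasure lebesgue {x \<in> Q0. \<bar>f x\<bar> > s}"
      by (subst emeasure_restrict_space) (auto intro: arg_cong[where f="emeasure lebesgue"])
    finally show ?thesis
      using superlevel_sets[OF f] by (simp add: distf_def emeasure_eq_measure2)
  qed
  then show "emeasure ?M {s<..} < \<infinity>" for s by simp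
  have en: "emeasure ?N {s<..} = emeasure lborel {t \<in> {0<..<1}. s < rearr f t}" for s
  proof -
    have "emeasure ?N {s<..} = emeasure (restrict_space lborel {0<..<1}) ({t. s < rearr f t} \<inter> {0<..<1})"
      using rearr_borel[OF f] by (subst emeasure_distr) (auto simp: vimage_def)
    also have "\<dots> = emeasure lborel {t \<in> {0<..<1}. s < rearr f t}"
      by (subst emeasure_restrict_space) (auto intro: arg_cong[where f="emeasure lborel"])
    finally show ?thesis .
  qed
  show "emeasure ?M {s<..} = emeasure ?N {s<..}" for s
  proof (cases "0 \<le> s")
    case True
    then show ?thesis unfolding em en rearr_superlevel[OF f True] by (simp add: distf_nonneg)
  next
    case False
    then have "{t \<in> {0<..<1}. s < rearr f t} = {0<..<1}"
      using rearr_nonneg[OF f] by force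
    moreover have "{x \<in> Q0. \<bar>f x\<bar> > s} = Q0" using False by force
    ultimately show ?thesis unfolding em en by (simp add: distf_def measure_Q0)
  qed
qed auto

section \<open>Dyadic coverings\<close>

text \<open>A point with a dyadic coordinate may lie outside its own cube \<open>dcube k x\<close>; such points form a
  null set, the complement of \<open>nondyadic\<close>.\<close>

definition dcube :: "nat \<Rightarrow> real^'n \<Rightarrow> (real^'n) set" where
  "dcube k x = {y. \<forall>i. of_int \<lfloor>2 ^ k * x $ i\<rfloor> < 2 ^ k * y $ i \<and>
                       2 ^ k * y $ i < of_int \<lfloor>2 ^ k * x $ i\<rfloor> + 1}"

definition nondyadic :: "(real^'n) set" where
  "nondyadic = {x. \<forall>k i. 2 ^ k * x $ i \<notin> \<int>}"

lemma dcube_eq_box: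
  "dcube k x = (let a = (\<chi> i. of_int \<lfloor>2 ^ k * x $ i\<rfloor> / 2 ^ k) in box a (a + (1 / 2 ^ k) *\<^sub>R One))"
  by (auto simp: dcube_def mem_box_cart One_nth field_simps Let_def simp del: sum_component)

lemma open_dcube [simp]: "open (dcube k x)"
  by (simp add: dcube_eq_box Let_def open_box)

lemma dcube_lmeasurable [simp]: "dcube k x \<in> lmeasurable"
  by (simp add: dcube_eq_box Let_def)

lemma measure_dcube: "measure lebesgue (dcube k (x :: real^'n)) = (1 / 2 ^ k) ^ CARD('n)"
  unfolding dcube_eq_box Let_def by (rule measure_cube) simp

lemma dcube_self: "x \<in> nondyadic \<Longrightarrow> x \<in> dcube k x"
  unfolding nondyadic_def dcube_def
  by (auto simp: less_le[of "of_int _"]) (metis Ints_of_int)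

lemma dcube_eqI: "y \<in> dcube k x \<Longrightarrow> dcube k y = dcube k x"
proof -
  assume y: "y \<in> dcube k x"
  have "\<lfloor>2 ^ k * y $ i\<rfloor> = \<lfloor>2 ^ k * x $ i\<rfloor>" for i
    using y by (intro floor_unique) (auto simp: dcube_def intro: less_imp_le)
  then show ?thesis by (simp add: dcube_def)
qed

lemma dcube_nested:
  assumes "k \<le> m"
  shows "dcube m x \<subseteq> dcube k x"
proof -
  have "dcube (Suc k) x \<subseteq> dcube k x" for k
  proof
    fix y assume y: "y \<in> dcube (Suc k) x"
    show "y \<in> dcube k x"
      unfolding dcube_def
    proof (rule CollectI, rule allI)
      fix i
      define a where "a = \<lfloor>2 ^ k * x $ i\<rfloor>"
      define b where "b = \<lfloor>2 ^ Suc k * x $ i\<rfloor>"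
      \<comment> \<open>The next dyadic interval is the left half (b = 2a) or the right half (b = 2a
        + 1) of the current one.\<close>
      have "2 * a \<le> b" "b \<le> 2 * a + 1"
        unfolding a_def b_def by (simp_all add: le_floor_iff) linarith+
      then have "2 * real_of_int a \<le> b" "real_of_int b \<le> 2 * a + 1" by linarith+
      moreover have "real_of_int b < 2 * (2 ^ k * y $ i)" "2 * (2 ^ k * y $ i) < b + 1"
        using y by (simp_all add: dcube_def b_def mult.assoc)
      ultimately show "real_of_int \<lfloor>2 ^ k * x $ i\<rfloor> < 2 ^ k * y $ i \<and>
          2 ^ k * y $ i < real_of_int \<lfloor>2 ^ k * x $ i\<rfloor> + 1"
        unfolding a_def[symmetric] by linarith
    qed
  qed
  then show ?thesis using lift_Suc_antimono_le[OF _ assms, of "\<lambda>k. dcube k x"] by blast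
qed

lemma dcube_0: "x \<in> Q0 \<Longrightarrow> dcube 0 x = Q0"
proof -
  assume "x \<in> Q0"
  then have "\<lfloor>x $ i\<rfloor> = 0" for i by (simp add: mem_Q0 floor_eq_iff less_imp_le)
  then show ?thesis by (auto simp: dcube_def mem_Q0)
qed

lemma dcube_subset_Q0: "x \<in> Q0 \<Longrightarrow> dcube k x \<subseteq> Q0"
  using dcube_nested[of 0 k x] dcube_0[of x] by simp

lemma is_cube_dcube: "x \<in> Q0 \<Longrightarrow> is_cube (dcube k x)"
  unfolding is_cube_def
  by (rule conjI, rule exI[of _ "\<chi> i. of_int \<lfloor>2 ^ k * x $ i\<rfloor> / 2 ^ k"], rule exI[of _ "1 / 2 ^ k"])
     (auto simp: dcube_eq_box Let_def dest: dcube_subset_Q0[of x k, THEN subsetD])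

text \<open>The point x need not lie in \<open>dcube k x\<close>, but it lies in the closure, so
  coordinates differ by at most 2^-k. The l1 norm then bounds the distance by n/2^k, which dictates
  the choice of k.\<close>

lemma dcube_shrinks:
  fixes x :: "real^'n"
  assumes "open U" "x \<in> U"
  obtains k where "dcube k x \<subseteq> U"
proof -
  obtain e where e: "e > 0" "ball x e \<subseteq> U" using assms openE by blast
  obtain k where k: "real CARD('n) / e < 2 ^ k"
    using real_arch_pow[of 2] by auto
  have "dcube k x \<subseteq> ball x e"
  proof
    fix y assume y: "y \<in> dcube k x"
    have "\<bar>(x - y) $ i\<bar> \<le> 1 / 2 ^ k" for i
    proof -
      have "real_of_int \<lfloor>2 ^ k * x $ i\<rfloor> < 2 ^ k * y $ i" "2 ^ k * y $ i < real_of_int \<lfloor>2 ^ k * x $ i\<rfloor> + 1"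
        using y by (auto simp: dcube_def)
      moreover have "real_of_int \<lfloor>2 ^ k * x $ i\<rfloor> \<le> 2 ^ k * x $ i"
        "2 ^ k * x $ i < real_of_int \<lfloor>2 ^ k * x $ i\<rfloor> + 1" by linarith+
      ultimately have "\<bar>2 ^ k * x $ i - 2 ^ k * y $ i\<bar> \<le> 1" by linarith
      then have "2 ^ k * \<bar>x $ i - y $ i\<bar> \<le> 1"
        by (simp add: abs_mult right_diff_distrib[symmetric] del: right_diff_distrib_numeral)
      then show ?thesis by (simp add: field_simps)
    qed
    then have "norm (x - y) \<le> (\<Sum>i\<in>(UNIV :: 'n set). 1 / 2 ^ k)"
      by (intro order_trans[OF norm_le_l1_cart] sum_mono) auto
    also have "\<dots> < e" using k e by (simp add: field_simps)
    finally show "y \<in> ball x e" by (simp add: dist_norm)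
  qed
  then show ?thesis using e that by blast
qed

lemma negligible_dyadic: "negligible (- (nondyadic :: (real^'n) set))"
proof -
  have "- (nondyadic :: (real^'n) set) \<subseteq> (\<Union>(k, i, m) \<in> UNIV. {x. x $ i = of_int m / 2 ^ k})"
  proof
    fix x :: "real^'n" assume "x \<in> - nondyadic"
    then obtain k i where "2 ^ k * x $ i \<in> \<int>" by (auto simp: nondyadic_def)
    then obtain m where "2 ^ k * x $ i = of_int m" by (auto elim: Ints_cases)
    then have "x $ i = of_int m / 2 ^ k" by (simp add: field_simps)
    then show "x \<in> (\<Union>(k, i, m) \<in> UNIV. {x. x $ i = of_int m / 2 ^ k})" by auto
  qed
  moreover have "negligible (\<Union>(k::nat, i::'n, m::int) \<in> UNIV. {x :: real^'n. x $ i = of_int m / 2 ^ k})"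
    by (rule negligible_countable_Union)
       (auto simp: cart_eq_inner_axis intro!: negligible_standard_hyperplane)
  ultimately show ?thesis by (rule negligible_subset[rotated])
qed

text \<open>A Calderon--Zygmund stopping-time argument for the indicator of \<open>U\<close>: around every
  non-dyadic point of \<open>U\<close> take the largest dyadic cube in which \<open>U\<close> has density above
  \<open>2\<^bsup>-(n+1)\<^esup>\<close>. Its dyadic parent bounds the density from above by \<open>1/2\<close>.\<close>
lemma half_density_cover:
  fixes U :: "(real^'n) set"
  assumes U: "open U" "U \<subseteq> Q0" and small: "2 ^ (CARD('n) + 1) * measure lebesgue U \<le> 1"
  obtains F where "F \<in> cube_families" "negligible (U - \<Union>F)"
    "\<And>Q. Q \<in> F \<Longrightarrow> 2 * measure lebesgue (Q \<inter> U) \<le> measure lebesgue Q"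
    "\<And>F'. F' \<subseteq> F \<Longrightarrow> finite F' \<Longrightarrow>
      measure lebesgue (\<Union>F') \<le> 2 ^ (CARD('n) + 1) * measure lebesgue U"
proof -
  define N where "N = (2::real) ^ (CARD('n) + 1)"
  have N: "N > 0" by (simp add: N_def)
  have Um: "U \<in> lmeasurable"
    by (rule fmeasurableI2[OF Q0_lmeasurable U(2)]) (simp add: U)
  define dense where "dense = (\<lambda>Q. measure lebesgue Q < N * measure lebesgue (Q \<inter> U))"
  define D where "D = U \<inter> nondyadic"
  define kk where "kk = (\<lambda>x. LEAST k. dense (dcube k x))"
  have ex: "\<exists>k. dense (dcube k x)" if x: "x \<in> U" for x
  proof -
    obtain k where "dcube k x \<subseteq> U" using dcube_shrinks[OF U(1) x] by blast
    then have "dcube k x \<inter> U = dcube k x" by auto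
    moreover have "1 < N" by (simp add: N_def less_1_mult)
    moreover have "0 < measure lebesgue (dcube k x)" by (simp add: measure_dcube)
    ultimately show ?thesis by (intro exI[of _ k]) (simp add: dense_def)
  qed
  have kk: "dense (dcube (kk x) x)" if "x \<in> U" for x
    unfolding kk_def using ex[OF that] by (rule LeastI_ex)
  have kk_le: "kk x \<le> k" if "dense (dcube k x)" for k x
    unfolding kk_def using that by (rule Least_le)
  have half: "2 * measure lebesgue (dcube (kk x) x \<inter> U) \<le> measure lebesgue (dcube (kk x) x)"
    if x: "x \<in> U" for x
  proof -
    \<comment> \<open>The smallness of U says exactly that \<open>Q0\<close> is not
      \<open>dense\<close>. The selection therefore stops strictly below the top, and the selected
      cube has a dyadic parent that was rejected.\<close>
    have "kk x \<noteq> 0"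
    proof
      assume "kk x = 0"
      then have "dense Q0" using kk[OF x] dcube_0[of x] x U by auto
      moreover have "Q0 \<inter> U = U" using U by auto
      ultimately show False using small by (simp add: dense_def N_def measure_Q0)
    qed
    then obtain j where j: "kk x = Suc j" by (cases "kk x") auto
    then have "\<not> dense (dcube j x)" using kk_le[of j x] by auto
    then have "N * measure lebesgue (dcube j x \<inter> U) \<le> measure lebesgue (dcube j x)"
      by (simp add: dense_def)
    moreover have "measure lebesgue (dcube (Suc j) x \<inter> U) \<le> measure lebesgue (dcube j x \<inter> U)"
      using dcube_nested[of j "Suc j" x] Um
      by (intro measure_mono_fmeasurable) (auto intro: fmeasurableD fmeasurable.Int)
    ultimately have "N * measure lebesgue (dcube (Suc j) x \<inter> U) \<le> measure lebesgue (dcube j x)"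
      using N mult_left_mono[of _ _ N] by (meson less_imp_le order_trans)
    moreover have "measure lebesgue (dcube j x) = 2 ^ CARD('n) * measure lebesgue (dcube (Suc j) x)"
      by (simp add: measure_dcube power_divide power_mult_distrib)
    ultimately have "2 ^ CARD('n) * (2 * measure lebesgue (dcube (Suc j) x \<inter> U))
        \<le> 2 ^ CARD('n) * measure lebesgue (dcube (Suc j) x)"
      by (simp add: N_def mult.assoc)
    then show ?thesis unfolding j by (subst (asm) mult_le_cancel_left_pos) auto
  qed
  define F where "F = (\<lambda>x. dcube (kk x) x) ` D"
  \<comment> \<open>Dyadic cubes that meet are nested. The larger cube, selected at x, contains z,
    which is non-dyadic and so lies in its own cube; minimality of \<open>kk z\<close> then rules
    out a strictly smaller cube at z.\<close>
  have same: "dcube (kk x) x = dcube (kk z) z"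
    if "x \<in> D" "z \<in> D" "y \<in> dcube (kk x) x" "y \<in> dcube (kk z) z" "kk x \<le> kk z" for x y z
  proof -
    have 1: "dcube (kk x) y = dcube (kk x) x" "dcube (kk z) y = dcube (kk z) z"
      using that dcube_eqI by auto
    have "z \<in> dcube (kk x) x"
      using dcube_self[of z "kk z"] that(2) dcube_nested[OF that(5), of y] 1 by (auto simp: D_def)
    then have 2: "dcube (kk x) z = dcube (kk x) x" by (rule dcube_eqI)
    then have "dense (dcube (kk x) z)" using kk[of x] that(1) by (simp add: D_def)
    then have "kk z = kk x" using kk_le[of "kk x" z] that by simp
    then show ?thesis using 2 by simp
  qed
  have disj: "Q \<inter> Q' = {}" if QQ: "Q \<in> F" "Q' \<in> F" "Q \<noteq> Q'" for Q Q'
  proof (rule ccontr)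
    assume "Q \<inter> Q' \<noteq> {}"
    then obtain y where y: "y \<in> Q" "y \<in> Q'" by auto
    obtain x z where xz: "x \<in> D" "z \<in> D" "Q = dcube (kk x) x" "Q' = dcube (kk z) z"
      using QQ by (auto simp: F_def)
    show False
      using same[of x z y] same[of z x y] xz y QQ(3) by (cases "kk x \<le> kk z") auto
  qed
  have "countable F"
    by (rule countable_disjoint_open_subsets) (use disj in \<open>auto simp: F_def pairwise_def disjnt_def\<close>)
  moreover have "is_cube Q" if "Q \<in> F" for Q
    using that U by (auto simp: F_def D_def intro!: is_cube_dcube)
  ultimately have fam: "F \<in> cube_families" using disj by (auto simp: cube_families_def)
  have "U - \<Union>F \<subseteq> - nondyadic"
    using dcube_self by (auto simp: F_def D_def)
  then have neg: "negligible (U - \<Union>F)" by (rule negligible_subset[OF negligible_dyadic])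
  \<comment> \<open>Each selected cube has measure below N times that of its trace on U, and the
    traces are disjoint subsets of U.\<close>
  have fin: "measure lebesgue (\<Union>F') \<le> N * measure lebesgue U" if F': "F' \<subseteq> F" "finite F'" for F'
  proof -
    have meas: "Q \<in> lmeasurable" if "Q \<in> F'" for Q
      using that F' by (auto simp: F_def)
    have "measure lebesgue (\<Union>F') \<le> (\<Sum>Q\<in>F'. measure lebesgue Q)"
      using measure_UNION_le[OF F'(2), of "\<lambda>Q. Q" lebesgue] meas by (auto simp: fmeasurableD)
    also have "\<dots> \<le> (\<Sum>Q\<in>F'. N * measure lebesgue (Q \<inter> U))"
    proof (rule sum_mono)
      fix Q assume "Q \<in> F'"
      then obtain x where "x \<in> U" "Q = dcube (kk x) x" using F' by (auto simp: F_def D_def)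
      then show "measure lebesgue Q \<le> N * measure lebesgue (Q \<inter> U)"
        using kk[of x] by (simp add: dense_def)
    qed
    also have "\<dots> = N * (\<Sum>Q\<in>F'. measure lebesgue (Q \<inter> U))" by (simp add: sum_distrib_left)
    also have "(\<Sum>Q\<in>F'. measure lebesgue (Q \<inter> U)) = measure lebesgue (\<Union>Q\<in>F'. Q \<inter> U)"
    proof (intro measure_UNION'[symmetric] F'(2))
      show "Q \<inter> U \<in> lmeasurable" if "Q \<in> F'" for Q
        using meas[OF that] Um by (rule fmeasurable.Int)
      have "disjnt (Q \<inter> U) (Q' \<inter> U)" if "Q \<in> F'" "Q' \<in> F'" "Q \<noteq> Q'" for Q Q'
        using disj[of Q Q'] that F' by (auto simp: disjnt_def)
      then show "pairwise (\<lambda>Q Q'. disjnt (Q \<inter> U) (Q' \<inter> U)) F'"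
        by (simp add: pairwise_def)
    qed
    also have "\<dots> \<le> measure lebesgue U"
      using meas Um F' by (intro measure_mono_fmeasurable) (auto intro!: sets.finite_UN sets.Int fmeasurableD)
    finally show ?thesis using N by simp
  qed
  show ?thesis
  proof (rule that[OF fam neg])
    show "2 * measure lebesgue (Q \<inter> U) \<le> measure lebesgue Q" if "Q \<in> F" for Q
      using that half by (auto simp: F_def D_def)
  qed (use fin in \<open>auto simp: N_def\<close>)
qed

section \<open>Oscillation on cubes\<close>

lemma set_integral_lebesgue_on:
  fixes f :: "real^'n \<Rightarrow> real"
  assumes "S \<in> sets lebesgue" "S \<subseteq> T" "T \<in> sets lebesgue"
  shows "(LINT x:S|lebesgue. f x) = (LINT x|lebesgue_on T. indicator S x * f x)"
proof -
  have "(\<lambda>x. indicator T x * (indicator S x * f x)) = (\<lambda>x. indicator S x * f x)"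
    using assms(2) by (intro ext) (auto simp: indicator_def)
  then show ?thesis
    using assms by (simp add: set_lebesgue_integral_def integral_restrict_space del: mult_eq_0_iff)
qed

lemma set_integral_lebesgue_on_self:
  fixes f :: "real^'n \<Rightarrow> real"
  assumes "S \<in> sets lebesgue"
  shows "(LINT x:S|lebesgue. f x) = (LINT x|lebesgue_on S. f x)"
  using assms by (simp add: set_lebesgue_integral_def integral_restrict_space)

lemma set_integrable_lebesgue_on:
  fixes f :: "real^'n \<Rightarrow> real"
  assumes "integrable (lebesgue_on T) f" "S \<in> sets lebesgue" "S \<subseteq> T" "T \<in> sets lebesgue"
  shows "set_integrable lebesgue S f" "integrable (lebesgue_on S) f"
proof -
  have "set_integrable lebesgue T f"
    using assms by (simp add: set_integrable_def integrable_restrict_space)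
  then show 1: "set_integrable lebesgue S f"
    by (rule set_integrable_subset) (use assms in auto)
  then show "integrable (lebesgue_on S) f"
    using assms by (simp add: set_integrable_def integrable_restrict_space)
qed

lemma is_cube_lmeasurable: "is_cube Q \<Longrightarrow> Q \<in> lmeasurable"
  by (auto simp: is_cube_def)

lemma is_cube_subset: "is_cube Q \<Longrightarrow> Q \<subseteq> Q0"
  by (simp add: is_cube_def)

lemma is_cube_measure_pos: "is_cube Q \<Longrightarrow> measure lebesgue Q > 0"
  unfolding is_cube_def by (metis less_imp_le measure_cube zero_less_power)

lemma is_cube_Q0: "is_cube Q0"
  unfolding is_cube_def by (rule conjI, rule exI[of _ 0], rule exI[of _ 1]) (auto simp: Q0_def)

lemma Q0_family: "{Q0} \<in> cube_families"
  by (simp add: cube_families_def is_cube_Q0)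

context
  fixes f :: "real^'n \<Rightarrow> real" and Q :: "(real^'n) set"
  assumes f: "integrable (lebesgue_on Q0) f" and Q: "is_cube Q"
begin

lemma Q_sets: "Q \<in> sets lebesgue"
  using is_cube_lmeasurable[OF Q] by (rule fmeasurableD)

lemma integrable_on_cube: "integrable (lebesgue_on Q) f"
  using set_integrable_lebesgue_on(2)[OF f Q_sets is_cube_subset[OF Q]] by simp

interpretation M: finite_measure "lebesgue_on Q"
  by (rule finite_measure_lebesgue_on[OF is_cube_lmeasurable[OF Q]])

lemma integrable_diff_on_cube: "integrable (lebesgue_on Q) (\<lambda>y. \<bar>f x - f y\<bar>)"
  using integrable_on_cube by auto

lemma measure_on_cube: "measure (lebesgue_on Q) Q = measure lebesgue Q"
  using Q_sets by (simp add: measure_restrict_space)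

lemma osc_inner_le:
  "(LINT y|lebesgue_on Q. \<bar>f x - f y\<bar>) \<le> measure lebesgue Q * \<bar>f x\<bar> + (LINT y|lebesgue_on Q. \<bar>f y\<bar>)"
proof -
  have "(LINT y|lebesgue_on Q. \<bar>f x - f y\<bar>) \<le> (LINT y|lebesgue_on Q. \<bar>f x\<bar> + \<bar>f y\<bar>)"
    using integrable_on_cube by (intro integral_mono integrable_diff_on_cube) auto
  also have "\<dots> = measure lebesgue Q * \<bar>f x\<bar> + (LINT y|lebesgue_on Q. \<bar>f y\<bar>)"
    using integrable_on_cube Q_sets measure_on_cube by (subst Bochner_Integration.integral_add) auto
  finally show ?thesis .
qed

text \<open>The measure on Q is finite: this gives measurability of the inner integral in x, as for
  Fubini, and integrability of the constant in the dominating function from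
  \<open>osc_inner_le\<close>.\<close>

lemma integrable_osc_inner:
  "integrable (lebesgue_on Q) (\<lambda>x. LINT y|lebesgue_on Q. \<bar>f x - f y\<bar>)"
proof (rule Bochner_Integration.integrable_bound)
  show "integrable (lebesgue_on Q) (\<lambda>x. measure lebesgue Q * \<bar>f x\<bar> + (LINT y|lebesgue_on Q. \<bar>f y\<bar>))"
    using integrable_on_cube by auto
  have [measurable]: "f \<in> borel_measurable (lebesgue_on Q)" using integrable_on_cube by auto
  show "(\<lambda>x. LINT y|lebesgue_on Q. \<bar>f x - f y\<bar>) \<in> borel_measurable (lebesgue_on Q)"
    by (rule M.borel_measurable_lebesgue_integral) measurable
  show "AE x in lebesgue_on Q. norm (LINT y|lebesgue_on Q. \<bar>f x - f y\<bar>)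
      \<le> norm (measure lebesgue Q * \<bar>f x\<bar> + (LINT y|lebesgue_on Q. \<bar>f y\<bar>))"
    using osc_inner_le by (intro AE_I2) (simp add: abs_of_nonneg)
qed

lemma osc_term_eq:
  "measure lebesgue Q * osc_term f Q =
    (LINT x|lebesgue_on Q. LINT y|lebesgue_on Q. \<bar>f x - f y\<bar>)"
  using is_cube_measure_pos[OF Q]
  by (simp add: osc_term_def set_integral_lebesgue_on_self Q_sets)

lemma osc_term_nonneg: "osc_term f Q \<ge> 0"
proof -
  have "0 \<le> measure lebesgue Q * osc_term f Q" unfolding osc_term_eq by simp
  then show ?thesis using is_cube_measure_pos[OF Q] by (simp add: zero_le_mult_iff)
qed

text \<open>The triangle inequality integrated in both variables; each variable contributes one
  integral of |f|. This is the source of the constant 2 in the theorem.\<close>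

lemma osc_term_le: "osc_term f Q \<le> 2 * (LINT x:Q|lebesgue. \<bar>f x\<bar>)"
proof -
  have "measure lebesgue Q * osc_term f Q \<le>
      (LINT x|lebesgue_on Q. measure lebesgue Q * \<bar>f x\<bar> + (LINT y|lebesgue_on Q. \<bar>f y\<bar>))"
    unfolding osc_term_eq using integrable_on_cube
    by (intro integral_mono integrable_osc_inner osc_inner_le) auto
  also have "\<dots> = measure lebesgue Q * (2 * (LINT x:Q|lebesgue. \<bar>f x\<bar>))"
    using integrable_on_cube Q_sets measure_on_cube
    by (subst Bochner_Integration.integral_add) (auto simp: set_integral_lebesgue_on_self)
  finally show ?thesis using is_cube_measure_pos[OF Q] by simp
qed

text \<open>Only the part A x B of the double integral is kept. In the application A holds the large
  values of f and B the small ones.\<close>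

lemma osc_term_ge:
  assumes AB: "A \<in> sets lebesgue" "A \<subseteq> Q" "B \<in> sets lebesgue" "B \<subseteq> Q"
    and d: "0 \<le> d" "\<And>x y. x \<in> A \<Longrightarrow> y \<in> B \<Longrightarrow> d \<le> \<bar>f x - f y\<bar>"
  shows "d * measure lebesgue A * measure lebesgue B \<le> measure lebesgue Q * osc_term f Q"
proof -
  have AB': "A \<in> sets (lebesgue_on Q)" "B \<in> sets (lebesgue_on Q)"
    using AB Q_sets by (auto simp: sets_restrict_space_iff)
  have m: "measure (lebesgue_on Q) A = measure lebesgue A" "measure (lebesgue_on Q) B = measure lebesgue B"
    using AB Q_sets by (auto simp: measure_restrict_space)
  have ind: "integrable (lebesgue_on Q) (indicator A :: _ \<Rightarrow> real)"
    "integrable (lebesgue_on Q) (indicator B :: _ \<Rightarrow> real)"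
    using AB' M.emeasure_finite[of A] M.emeasure_finite[of B]
    by (auto intro!: integrable_real_indicator simp: less_top[symmetric])
  have inner: "d * measure lebesgue B \<le> (LINT y|lebesgue_on Q. \<bar>f x - f y\<bar>)" if "x \<in> A" for x
  proof -
    have "d * measure lebesgue B = (LINT y|lebesgue_on Q. d * indicator B y)"
      using AB' m AB by (simp add: Int_absorb2)
    also have "\<dots> \<le> (LINT y|lebesgue_on Q. \<bar>f x - f y\<bar>)"
      using ind d that by (intro integral_mono integrable_diff_on_cube integrable_mult_right) (auto split: split_indicator)
    finally show ?thesis .
  qed
  have "d * measure lebesgue A * measure lebesgue B
      = (LINT x|lebesgue_on Q. (d * measure lebesgue B) * indicator A x)"
    using AB' m AB by (simp add: Int_absorb2)
  also have "\<dots> \<le> (LINT x|lebesgue_on Q. LINT y|lebesgue_on Q. \<bar>f x - f y\<bar>)"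
    using ind d inner by (intro integral_mono integrable_osc_inner integrable_mult_right) (auto split: split_indicator)
  finally show ?thesis by (simp add: osc_term_eq)
qed

end

text \<open>Constants cancel in f x - f y. Hence f and f minus its average have the same
  \<open>Gamma\<close>, and any admissible function for one serves for the other.\<close>

lemma osc_term_shift: "osc_term (\<lambda>x. f x - c) Q = osc_term f Q"
  by (simp add: osc_term_def)

text \<open>As \<open>Q0\<close> has measure 1, f x - avg is the integral of f x - f y over y; the
  absolute value moves inside.\<close>

lemma L1_dist_avg_le_osc:
  fixes f :: "real^'n \<Rightarrow> real"
  assumes f: "integrable (lebesgue_on Q0) f"
  shows "(LINT x|lebesgue_on Q0. \<bar>f x - avg Q0 f\<bar>) \<le> osc_term f Q0"
proof -
  interpret M: finite_measure "lebesgue_on Q0 :: (real^'n) measure"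
    by (rule finite_measure_lebesgue_on) simp
  have one: "measure (lebesgue_on Q0) (Q0 :: (real^'n) set) = 1"
    by (simp add: measure_restrict_space measure_Q0)
  have avg: "avg Q0 f = (LINT y|lebesgue_on Q0. f y)"
    by (simp add: avg_def measure_Q0 set_integral_lebesgue_on_self)
  have "\<bar>f x - avg Q0 f\<bar> \<le> (LINT y|lebesgue_on Q0. \<bar>f x - f y\<bar>)" for x
  proof -
    have "f x - avg Q0 f = (LINT y|lebesgue_on Q0. f x - f y)"
      using f one by (subst Bochner_Integration.integral_diff) (auto simp: avg)
    then show ?thesis by (simp only: integral_abs_bound)
  qed
  then have "(LINT x|lebesgue_on Q0. \<bar>f x - avg Q0 f\<bar>) \<le>
      (LINT x|lebesgue_on Q0. LINT y|lebesgue_on Q0. \<bar>f x - f y\<bar>)"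
    using f by (intro integral_mono integrable_osc_inner[OF f is_cube_Q0]) auto
  also have "\<dots> = osc_term f Q0"
    using osc_term_eq[OF f is_cube_Q0] by (simp add: measure_Q0)
  finally show ?thesis .
qed

section \<open>The averaged rearrangement\<close>

lemma integrable_rearr:
  fixes g :: "real^'n \<Rightarrow> real"
  assumes g: "integrable (lebesgue_on Q0) g"
  shows "integrable (restrict_space lborel {0<..<1}) (rearr g)"
proof -
  have gm: "g \<in> borel_measurable (lebesgue_on Q0)" using g by auto
  have "integrable (distr (lebesgue_on Q0) borel (\<lambda>x. \<bar>g x\<bar>)) (\<lambda>u. u)"
    using g by (subst integrable_distr_eq) auto
  then show ?thesis
    unfolding distr_rearr[OF gm] using rearr_borel[OF gm] by (subst (asm) integrable_distr_eq) auto
qed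

lemma integral_rearr:
  fixes g :: "real^'n \<Rightarrow> real" and \<phi> :: "real \<Rightarrow> real"
  assumes g: "g \<in> borel_measurable (lebesgue_on Q0)" and [measurable]: "\<phi> \<in> borel_measurable borel"
  shows "(LINT x|lebesgue_on Q0. \<phi> \<bar>g x\<bar>) = (LINT s|restrict_space lborel {0<..<1}. \<phi> (rearr g s))"
proof -
  have "(LINT x|lebesgue_on Q0. \<phi> \<bar>g x\<bar>) = (LINT u|distr (lebesgue_on Q0) borel (\<lambda>x. \<bar>g x\<bar>). \<phi> u)"
    using g by (subst integral_distr) auto
  also have "\<dots> = (LINT s|restrict_space lborel {0<..<1}. \<phi> (rearr g s))"
    unfolding distr_rearr[OF g] using rearr_borel[OF g] by (subst integral_distr) auto
  finally show ?thesis .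
qed

lemma set_integrable_rearr:
  fixes g :: "real^'n \<Rightarrow> real"
  assumes g: "integrable (lebesgue_on Q0) g" and "S \<in> sets borel" "S \<subseteq> {0<..<1}"
  shows "set_integrable lborel S (rearr g)"
proof -
  have "set_integrable lborel {0<..<1} (rearr g)"
    using integrable_rearr[OF g] by (simp add: set_integrable_def integrable_restrict_space)
  then show ?thesis by (rule set_integrable_subset) (use assms in auto)
qed

lemma rearr2_eq:
  assumes "0 < t" "t \<le> 1"
  shows "t * rearr2 g t = (LINT s|restrict_space lborel {0<..<1}. indicator {0<..<t} s * rearr g s)"
proof -
  have "(\<lambda>s. indicator {0<..<1} s * (indicator {0<..<t} s * rearr g s)) =
      (\<lambda>s. indicator {0<..<t} s * rearr g s)"
    using assms by (intro ext) (auto simp: indicator_def)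
  then show ?thesis
    using assms by (simp add: rearr2_def set_lebesgue_integral_def integral_restrict_space)
qed

text \<open>From \<open>\<integral>\<^sub>G \<bar>g\<bar> \<le> \<lambda> \<bar>G\<bar> + \<integral> (\<bar>g\<bar> - \<lambda>)\<^sub>+\<close> with \<open>\<lambda> = rearr g t\<close>.\<close>
lemma hardy_littlewood:
  fixes g :: "real^'n \<Rightarrow> real"
  assumes g: "integrable (lebesgue_on Q0) g"
    and G: "G \<in> sets lebesgue" "G \<subseteq> Q0" "measure lebesgue G \<le> t" and t: "0 < t" "t \<le> 1"
  shows "(LINT x:G|lebesgue. \<bar>g x\<bar>) \<le> t * rearr2 g t"
proof -
  interpret M: finite_measure "lebesgue_on Q0 :: (real^'n) measure"
    by (rule finite_measure_lebesgue_on) simp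
  let ?N = "restrict_space lborel {0<..<1::real}"
  have gm: "g \<in> borel_measurable (lebesgue_on Q0)" using g by auto
  define l where "l = rearr g t"
  have l: "l \<ge> 0" using rearr_nonneg[OF gm t(1)] by (simp add: l_def)
  have Gs: "G \<in> sets (lebesgue_on Q0)" using G by (simp add: sets_restrict_space_iff)
  have mG: "measure (lebesgue_on Q0) G = measure lebesgue G"
    using G by (simp add: measure_restrict_space)
  have intG: "integrable (lebesgue_on Q0) (indicator G :: _ \<Rightarrow> real)"
    using Gs M.emeasure_finite[of G] by (intro integrable_real_indicator) (auto simp: less_top[symmetric])
  have int1: "integrable (lebesgue_on Q0) (\<lambda>x. max 0 (\<bar>g x\<bar> - l))"
    using g by (intro integrable_max) auto
  have "integrable (lebesgue_on Q0) (\<lambda>x. indicator G x * \<bar>g x\<bar>)"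
    using integrable_real_mult_indicator[OF Gs integrable_abs[OF g]] by (simp add: mult.commute)
  moreover have "indicator G x * \<bar>g x\<bar> \<le> l * indicator G x + max 0 (\<bar>g x\<bar> - l)" for x
    using l by (auto simp: indicator_def)
  ultimately have "(LINT x:G|lebesgue. \<bar>g x\<bar>) \<le>
      (LINT x|lebesgue_on Q0. l * indicator G x + max 0 (\<bar>g x\<bar> - l))"
    unfolding set_integral_lebesgue_on[OF G(1,2) Q0_sets] using int1 intG
    by (intro integral_mono) auto
  also have "\<dots> = l * measure lebesgue G + (LINT x|lebesgue_on Q0. max 0 (\<bar>g x\<bar> - l))"
    using int1 intG mG G by (subst Bochner_Integration.integral_add) (auto simp: Int_absorb2)
  also have "\<dots> \<le> l * t + (LINT x|lebesgue_on Q0. max 0 (\<bar>g x\<bar> - l))"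
    using G l by (simp add: mult_left_mono)
  also have "(LINT x|lebesgue_on Q0. max 0 (\<bar>g x\<bar> - l)) = (LINT s|?N. max 0 (rearr g s - l))"
    by (rule integral_rearr[OF gm]) simp
  \<comment> \<open>\<open>rearr g\<close> decreases and l is its value at t, so the positive part
    vanishes beyond t and equals \<open>rearr g s - l\<close> before it. Its l t cancels the one
    from the first term.\<close>
  also have "\<dots> = (LINT s|?N. indicator {0<..<t} s * rearr g s - l * indicator {0<..<t} s)"
  proof (rule Bochner_Integration.integral_cong[OF refl])
    fix s assume "s \<in> space ?N"
    then have s: "0 < s" "s < 1" by (auto simp: space_restrict_space)
    show "max 0 (rearr g s - l) = indicator {0<..<t} s * rearr g s - l * indicator {0<..<t} s"
      using rearr_antimono[OF gm s(1), of t] rearr_antimono[OF gm t(1), of s] s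
      by (cases "s < t") (auto simp: l_def indicator_def)
  qed
  also have "\<dots> = t * rearr2 g t - l * t"
  proof -
    have ts: "{0<..<t} \<in> sets ?N" using t by (auto simp: sets_restrict_space_iff)
    have mt: "measure ?N {0<..<t} = t" using t by (subst measure_restrict_space) auto
    have "emeasure ?N {0<..<t} < \<infinity>" using t by (subst emeasure_restrict_space) auto
    then have "integrable ?N (indicator {0<..<t} :: real \<Rightarrow> real)"
      using ts by (intro integrable_real_indicator)
    moreover have "integrable ?N (\<lambda>s. indicator {0<..<t} s * rearr g s)"
      using integrable_real_mult_indicator[OF ts integrable_rearr[OF g]] by (simp add: mult.commute)
    ultimately show ?thesis
      unfolding rearr2_eq[OF t] using ts mt t
      by (subst Bochner_Integration.integral_diff) auto
  qed
  finally show ?thesis by simp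
qed

lemma rearr_le_rearr2:
  fixes g :: "real^'n \<Rightarrow> real"
  assumes g: "integrable (lebesgue_on Q0) g" and t: "0 < t" "t \<le> 1"
  shows "rearr g t \<le> rearr2 g t"
proof -
  have gm: "g \<in> borel_measurable (lebesgue_on Q0)" using g by auto
  have "t * rearr g t = (LINT s:{0<..<t}|lborel. rearr g t)"
    using t by (simp add: set_lebesgue_integral_def)
  also have "\<dots> \<le> (LINT s:{0<..<t}|lborel. rearr g s)"
    using t by (intro set_integral_mono set_integrable_rearr[OF g] rearr_antimono[OF gm])
      (auto simp: set_integrable_def)
  also have "\<dots> = t * rearr2 g t" using t by (simp add: rearr2_def)
  finally show ?thesis using t by simp
qed

lemma rearr2_nonneg:
  fixes g :: "real^'n \<Rightarrow> real"
  assumes g: "integrable (lebesgue_on Q0) g" and t: "0 < t" "t \<le> 1"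
  shows "0 \<le> rearr2 g t"
  using rearr_le_rearr2[OF assms] rearr_nonneg[of g t] g t by auto

text \<open>On [t, u) the integrand is at most \<open>rearr g t\<close>, which is at most the mean
  over (0, t); appending this interval cannot raise the mean.\<close>

lemma rearr2_antimono:
  fixes g :: "real^'n \<Rightarrow> real"
  assumes g: "integrable (lebesgue_on Q0) g" and t: "0 < t" "t \<le> u" "u \<le> 1"
  shows "rearr2 g u \<le> rearr2 g t"
proof -
  have gm: "g \<in> borel_measurable (lebesgue_on Q0)" using g by auto
  have "u * rearr2 g u = (LINT s:{0<..<t} \<union> {t..<u}|lborel. rearr g s)"
    using t by (simp add: rearr2_def ivl_disj_un_two(1) ivl_disj_un)
  also have "\<dots> = (LINT s:{0<..<t}|lborel. rearr g s) + (LINT s:{t..<u}|lborel. rearr g s)"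
    using t by (intro set_integral_Un set_integrable_rearr[OF g]) auto
  also have "(LINT s:{t..<u}|lborel. rearr g s) \<le> (LINT s:{t..<u}|lborel. rearr g t)"
    using t by (intro set_integral_mono set_integrable_rearr[OF g] rearr_antimono[OF gm])
      (auto simp: set_integrable_def)
  also have "(LINT s:{t..<u}|lborel. rearr g t) = (u - t) * rearr g t"
    using t by (simp add: set_lebesgue_integral_def)
  also have "\<dots> \<le> (u - t) * rearr2 g t"
    using t rearr_le_rearr2[OF g t(1)] by (intro mult_left_mono) auto
  also have "(LINT s:{0<..<t}|lborel. rearr g s) = t * rearr2 g t"
    using t by (simp add: rearr2_def)
  finally have "u * rearr2 g u \<le> u * rearr2 g t" by (simp add: algebra_simps)
  then show ?thesis using t by simp
qed

section \<open>Pointwise estimate of the rearrangement\<close>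

text \<open>Lets the covering argument run over finite subfamilies, where sums and integrals need no
  convergence discussion.\<close>

lemma measure_countable_Union_le_finite:
  assumes "countable D" "\<And>d. d \<in> D \<Longrightarrow> d \<in> lmeasurable"
    and "\<And>D'. \<lbrakk>D' \<subseteq> D; finite D'\<rbrakk> \<Longrightarrow> measure lebesgue (\<Union>D') \<le> B"
  shows "measure lebesgue (\<Union>D) \<le> B"
proof (rule field_le_epsilon)
  fix e :: real assume "e > 0"
  then obtain D' where "D' \<subseteq> D" "finite D'" "measure lebesgue (\<Union>D) - e < measure lebesgue (\<Union>D')"
    using measure_countable_Union_approachable[OF assms(1) _ assms(2,3)] by blast
  then show "measure lebesgue (\<Union>D) \<le> B + e" using assms(3)[of D'] by linarith
qed

text \<open>Outer regularity. Openness puts small dyadic cubes around each point inside the set,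
  which is what starts the selection in \<open>half_density_cover\<close>.\<close>

lemma open_cover_in_Q0:
  fixes E :: "(real^'n) set"
  assumes "E \<in> sets lebesgue" "E \<subseteq> Q0" "e > 0"
  obtains U where "open U" "E \<subseteq> U" "U \<subseteq> Q0" "measure lebesgue U \<le> measure lebesgue E + e"
proof -
  obtain T where T: "open T" "E \<subseteq> T" "T - E \<in> lmeasurable" "emeasure lebesgue (T - E) < ennreal e"
    using sets_lebesgue_outer_open[OF assms(1,3)] by blast
  have Em: "E \<in> lmeasurable" by (rule fmeasurableI2[OF Q0_lmeasurable assms(2,1)])
  have "measure lebesgue (T - E) \<le> e"
    using T assms(3) by (simp add: emeasure_eq_measure2 ennreal_less_iff)
  moreover have "measure lebesgue (T \<inter> Q0) \<le> measure lebesgue (E \<union> (T - E))"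
    using T(1) by (intro measure_mono_fmeasurable fmeasurable.Un[OF Em T(3)]) auto
  moreover have "measure lebesgue (E \<union> (T - E)) \<le> measure lebesgue E + measure lebesgue (T - E)"
    using T(3) Em by (intro measure_Un_le fmeasurableD)
  ultimately show ?thesis
    using T assms open_Q0 by (intro that[of "T \<inter> Q0"]) auto
qed

text \<open>Cover the level set \<open>E = {\<bar>f\<bar> > l}\<close>, \<open>l = rearr f (2 t)\<close>, by cubes \<open>Q\<close> of which at least half
  lies outside \<open>E\<close>: comparing the values of \<open>f\<close> on \<open>Q \<inter> {\<bar>f\<bar> > l'}\<close> and on \<open>Q - E\<close> shows
  \<open>(l' - l) \<bar>Q \<inter> {\<bar>f\<bar> > l'}\<bar> \<le> 2 osc_term f Q\<close>.\<close>
lemma rearr_doubling: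
  fixes f \<gamma> :: "real^'n \<Rightarrow> real"
  defines "C \<equiv> (2::real) ^ (CARD('n) + 2)"
  assumes f: "integrable (lebesgue_on Q0) f" and \<gamma>: "integrable (lebesgue_on Q0) \<gamma>"
    and osc: "\<And>F. F \<in> cube_families \<Longrightarrow> finite F \<Longrightarrow>
      (\<Sum>Q\<in>F. osc_term f Q) \<le> (\<Sum>Q\<in>F. LINT x:Q|lebesgue. \<gamma> x)"
    and t: "0 < t" "2 * C * t \<le> 1"
  shows "rearr f t \<le> rearr f (2 * t) + 4 * C * rearr2 \<gamma> (2 * C * t)"
proof (rule ccontr)
  assume contra: "\<not> ?thesis"
  have C: "C > 0" by (simp add: C_def)
  have fm: "f \<in> borel_measurable (lebesgue_on Q0)" using f by auto
  define l where "l = rearr f (2 * t)"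
  define K where "K = 4 * C * rearr2 \<gamma> (2 * C * t)"
  have K: "K \<ge> 0" using rearr2_nonneg[OF \<gamma>, of "2 * C * t"] t C by (simp add: K_def)
  have l: "l \<ge> 0" using rearr_nonneg[OF fm, of "2 * t"] t by (simp add: l_def)
  \<comment> \<open>Both inequalities are strict on purpose: l' below \<open>rearr f t\<close> gives
    E' measure above t, and l' above l + K gives d > K. Together they contradict d |E'| \<le> K
    t.\<close>
  obtain l' where l': "l + K < l'" "l' < rearr f t"
    using contra dense[of "l + K" "rearr f t"] by (auto simp: l_def K_def)
  define E where "E = {x \<in> Q0. \<bar>f x\<bar> > l}"
  define E' where "E' = {x \<in> Q0. \<bar>f x\<bar> > l'}"
  have Em: "E \<in> lmeasurable" "E' \<in> lmeasurable"
    unfolding E_def E'_def by (rule superlevel_sets[OF fm])+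
  have mE: "measure lebesgue E \<le> 2 * t"
    using distf_rearr_le[OF fm, of "2 * t"] t by (simp add: E_def l_def distf_def)
  have mE': "measure lebesgue E' > t"
    using less_rearr_iff[OF fm t(1), of l'] l l' K by (simp add: E'_def distf_def)
  have EE: "E' \<subseteq> E" using l' K by (auto simp: E_def E'_def)
  have "E \<in> sets lebesgue" "E \<subseteq> Q0" "2 * t > 0"
    using Em t by (auto simp: E_def fmeasurableD)
  \<comment> \<open>A slack of 2t brings the measure of U to at most 4t. Multiplied by the covering
    constant 2^(n+1) this is 2 C t, hence C = 2^(n+2).\<close>
  then obtain U where U: "open U" "E \<subseteq> U" "U \<subseteq> Q0"
    and "measure lebesgue U \<le> measure lebesgue E + 2 * t"
    by (rule open_cover_in_Q0)
  then have mU: "measure lebesgue U \<le> 4 * t" using mE by linarith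
  have Um: "U \<in> lmeasurable"
    by (rule fmeasurableI2[OF Q0_lmeasurable U(3)]) (simp add: U)
  have CU: "2 ^ (CARD('n) + 1) * measure lebesgue U \<le> 2 * C * t"
  proof -
    have "2 ^ (CARD('n) + 1) * measure lebesgue U \<le> 2 ^ (CARD('n) + 1) * (4 * t)"
      using mU by (intro mult_left_mono) auto
    also have "\<dots> = 2 * C * t" by (simp add: C_def)
    finally show ?thesis .
  qed
  obtain F where F: "F \<in> cube_families" "negligible (U - \<Union>F)"
    "\<And>Q. Q \<in> F \<Longrightarrow> 2 * measure lebesgue (Q \<inter> U) \<le> measure lebesgue Q"
    "\<And>F'. F' \<subseteq> F \<Longrightarrow> finite F' \<Longrightarrow>
      measure lebesgue (\<Union>F') \<le> 2 ^ (CARD('n) + 1) * measure lebesgue U"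
    using half_density_cover[OF U(1,3) order_trans[OF CU t(2)]] by blast
  have cube: "is_cube Q" if "Q \<in> F" for Q using F that by (auto simp: cube_families_def)
  have Qm: "Q \<in> lmeasurable" if "Q \<in> F" for Q using cube[OF that] by (rule is_cube_lmeasurable)
  have int\<gamma>: "set_integrable lebesgue Q \<gamma>" if "Q \<in> F" for Q
    using set_integrable_lebesgue_on(1)[OF \<gamma> fmeasurableD[OF Qm[OF that]] is_cube_subset[OF cube[OF that]]]
    by simp
  have disj: "Q \<inter> Q' = {}" if "Q \<in> F" "Q' \<in> F" "Q \<noteq> Q'" for Q Q'
    using F that by (auto simp: cube_families_def)
  define d where "d = l' - l"
  have d: "d > 0" "d > K" using l' K by (auto simp: d_def)
  have local_bound: "d * measure lebesgue (Q \<inter> E') \<le> 2 * osc_term f Q" if Q: "Q \<in> F" for Q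
  proof -
    have "measure lebesgue (Q - U) = measure lebesgue Q - measure lebesgue (Q \<inter> U)"
      using measurable_measure_Diff[of Q lebesgue "Q \<inter> U"] Qm[OF Q] Um
      by (simp add: fmeasurableD Diff_Int)
    then have "measure lebesgue Q \<le> 2 * measure lebesgue (Q - U)" using F(3)[OF Q] by linarith
    then have "d * measure lebesgue (Q \<inter> E') * measure lebesgue Q
        \<le> d * measure lebesgue (Q \<inter> E') * (2 * measure lebesgue (Q - U))"
      using d by (intro mult_left_mono) auto
    also have "\<dots> = 2 * (d * measure lebesgue (Q \<inter> E') * measure lebesgue (Q - U))" by simp
    also have "d * measure lebesgue (Q \<inter> E') * measure lebesgue (Q - U)
        \<le> measure lebesgue Q * osc_term f Q"
    proof (rule osc_term_ge[OF f cube[OF Q]])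
      fix x y assume "x \<in> Q \<inter> E'" "y \<in> Q - U"
      then have "\<bar>f x\<bar> > l'" "\<bar>f y\<bar> \<le> l"
        using U is_cube_subset[OF cube[OF Q]] by (auto simp: E'_def E_def not_less)
      then show "d \<le> \<bar>f x - f y\<bar>" by (simp add: d_def)
    qed (use Qm[OF Q] Em Um d in \<open>auto simp: fmeasurableD\<close>)
    finally show ?thesis using is_cube_measure_pos[OF cube[OF Q]] by (simp add: mult.commute)
  qed
  \<comment> \<open>A finite subfamily is again an admissible family, so its oscillations sum to at
    most the integral of |\<gamma>| over a set of measure at most 2 C t. By Hardy-Littlewood this is
    at most \<open>2 * C * t * rearr2 \<gamma> (2 * C * t)\<close>; the factor 2 from
    \<open>local_bound\<close> makes it K t.\<close>
  have fin: "d * measure lebesgue (\<Union>Q\<in>F'. Q \<inter> E') \<le> K * t" if F': "F' \<subseteq> F" "finite F'" for F'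
  proof -
    have "measure lebesgue (\<Union>Q\<in>F'. Q \<inter> E') \<le> (\<Sum>Q\<in>F'. measure lebesgue (Q \<inter> E'))"
      using F' Qm Em by (intro measure_UNION_le) (auto simp: fmeasurableD)
    then have "d * measure lebesgue (\<Union>Q\<in>F'. Q \<inter> E') \<le> d * (\<Sum>Q\<in>F'. measure lebesgue (Q \<inter> E'))"
      using d by (intro mult_left_mono) auto
    also have "\<dots> \<le> (\<Sum>Q\<in>F'. 2 * osc_term f Q)"
      unfolding sum_distrib_left using local_bound F' by (intro sum_mono) auto
    also have "\<dots> = 2 * (\<Sum>Q\<in>F'. osc_term f Q)" by (simp add: sum_distrib_left)
    also have "(\<Sum>Q\<in>F'. osc_term f Q) \<le> (\<Sum>Q\<in>F'. LINT x:Q|lebesgue. \<gamma> x)"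
    proof (rule osc[OF _ F'(2)])
      show "F' \<in> cube_families"
        using F(1) F' by (auto simp: cube_families_def countable_finite subset_iff)
    qed
    also have "\<dots> \<le> (\<Sum>Q\<in>F'. LINT x:Q|lebesgue. \<bar>\<gamma> x\<bar>)"
      using F' by (intro sum_mono set_integral_mono set_integrable_abs int\<gamma>) auto
    also have "\<dots> = (LINT x:(\<Union>Q\<in>F'. Q)|lebesgue. \<bar>\<gamma> x\<bar>)"
    proof (rule set_integral_finite_Union[symmetric, OF F'(2)])
      show "disjoint_family_on (\<lambda>Q. Q) F'" using disj F' by (auto simp: disjoint_family_on_def)
      show "set_integrable lebesgue Q (\<lambda>x. \<bar>\<gamma> x\<bar>)" "Q \<in> sets lebesgue" if "Q \<in> F'" for Q
        using F' that by (auto intro!: set_integrable_abs int\<gamma> fmeasurableD Qm)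
    qed
    also have "\<dots> \<le> 2 * C * t * rearr2 \<gamma> (2 * C * t)"
    proof (rule hardy_littlewood[OF \<gamma>])
      show "(\<Union>Q\<in>F'. Q) \<in> sets lebesgue"
        using F' Qm by (intro sets.finite_UN) (auto intro: fmeasurableD)
      show "(\<Union>Q\<in>F'. Q) \<subseteq> Q0"
        using F' cube is_cube_subset by blast
      show "measure lebesgue (\<Union>Q\<in>F'. Q) \<le> 2 * C * t" using F(4)[OF F'] CU by simp
    qed (use t C in auto)
    finally show ?thesis by (simp add: K_def algebra_simps)
  qed
  have "measure lebesgue (\<Union>((\<lambda>Q. Q \<inter> E') ` F)) \<le> K * t / d"
  proof (rule measure_countable_Union_le_finite)
    show "countable ((\<lambda>Q. Q \<inter> E') ` F)" using F by (auto simp: cube_families_def)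
    show "A \<in> lmeasurable" if "A \<in> (\<lambda>Q. Q \<inter> E') ` F" for A using that Qm Em by auto
    fix D' assume "D' \<subseteq> (\<lambda>Q. Q \<inter> E') ` F" "finite D'"
    then obtain F' where "F' \<subseteq> F" "finite F'" "D' = (\<lambda>Q. Q \<inter> E') ` F'"
      by (meson finite_subset_image)
    then show "measure lebesgue (\<Union>D') \<le> K * t / d"
      using fin[of F'] d by (simp add: field_simps)
  qed
  moreover have "measure lebesgue E' \<le> measure lebesgue (\<Union>((\<lambda>Q. Q \<inter> E') ` F))"
  proof -
    have *: "(\<Union>((\<lambda>Q. Q \<inter> E') ` F)) \<in> lmeasurable"
    proof (rule fmeasurableI2[OF Em(2)])
      show "(\<Union>((\<lambda>Q. Q \<inter> E') ` F)) \<in> sets lebesgue"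
        using F(1) Qm Em
        by (intro sets.countable_UN'') (auto simp: cube_families_def intro!: fmeasurableD)
    qed auto
    have **: "U - \<Union>F \<in> lmeasurable" "measure lebesgue (U - \<Union>F) = 0"
      using F(2) by (auto simp: negligible_iff_measure)
    have "E' \<subseteq> (\<Union>((\<lambda>Q. Q \<inter> E') ` F)) \<union> (U - \<Union>F)" using EE U by auto
    then have "measure lebesgue E' \<le> measure lebesgue ((\<Union>((\<lambda>Q. Q \<inter> E') ` F)) \<union> (U - \<Union>F))"
      using * ** Em by (intro measure_mono_fmeasurable) auto
    also have "\<dots> \<le> measure lebesgue (\<Union>((\<lambda>Q. Q \<inter> E') ` F)) + measure lebesgue (U - \<Union>F)"
      using * ** by (intro measure_Un_le) auto
    finally show ?thesis using ** by simp
  qed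
  ultimately have "t < K * t / d" using mE' by linarith
  then have "t * d < t * K" using d by (simp add: field_simps)
  then show False using d t by simp
qed

section \<open>Summing the doubling inequality over dyadic scales\<close>

lemma set_integrable_divide_antimono:
  fixes \<psi> :: "real \<Rightarrow> real"
  assumes \<psi>: "\<And>s t. 0 < s \<Longrightarrow> s \<le> t \<Longrightarrow> t < 1 \<Longrightarrow> \<psi> t \<le> \<psi> s"
    and \<psi>0: "\<And>t. 0 < t \<Longrightarrow> t < 1 \<Longrightarrow> 0 \<le> \<psi> t"
    and S: "S \<in> sets borel" "S \<subseteq> {t<..<1}" and t: "0 < t"
  shows "set_integrable lborel S (\<lambda>s. \<psi> s / s)"
proof -
  have "\<psi> \<in> borel_measurable (restrict_space lborel {0<..<1})"
    using \<psi> by (rule borel_measurable_antimono)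
  then have "(\<lambda>s. \<psi> s / s) \<in> borel_measurable (restrict_space lborel {0<..<1})"
    by (intro borel_measurable_divide) (auto intro!: measurable_restrict_space1)
  then have m: "set_borel_measurable lborel {0<..<1} (\<lambda>s. \<psi> s / s)"
    by (simp add: set_borel_measurable_def borel_measurable_restrict_space_iff)
  have "set_integrable lborel {t<..<1} (\<lambda>s. \<psi> s / s)"
  proof (rule set_integrable_bound)
    show "set_integrable lborel {t<..<1} (\<lambda>s. \<psi> t / t)"
      unfolding set_integrable_def
      using emeasure_bounded_finite[of "{t<..<1}"]
      by (intro integrable_scaleR_left integrable_real_indicator) auto
    show "set_borel_measurable lborel {t<..<1} (\<lambda>s. \<psi> s / s)"
      by (rule set_borel_measurable_subset[OF m]) (use t in auto)
    have "\<bar>\<psi> s / s\<bar> \<le> \<bar>\<psi> t / t\<bar>" if "t < s" "s < 1" for s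
      using \<psi>[of t s] \<psi>0[of s] t that by (auto intro!: frac_le)
    then show "AE s in lborel. s \<in> {t<..<1} \<longrightarrow> norm (\<psi> s / s) \<le> norm (\<psi> t / t)" by auto
  qed
  then show ?thesis by (rule set_integrable_subset) (use S in auto)
qed

text \<open>As \<open>\<psi> (2 t) \<le> 2 \<integral>\<^bsub>(t, 2 t)\<^esub> \<psi> (s) ds / s\<close>, the increments add up to the integral.\<close>
lemma iterate_doubling:
  fixes \<phi> \<psi> :: "real \<Rightarrow> real"
  assumes \<phi>: "\<And>s t. 0 < s \<Longrightarrow> s \<le> t \<Longrightarrow> t < 1 \<Longrightarrow> \<phi> t \<le> \<phi> s"
    and \<psi>: "\<And>s t. 0 < s \<Longrightarrow> s \<le> t \<Longrightarrow> t < 1 \<Longrightarrow> \<psi> t \<le> \<psi> s"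
    and \<psi>0: "\<And>t. 0 < t \<Longrightarrow> t < 1 \<Longrightarrow> 0 \<le> \<psi> t"
    and K: "K \<ge> 0" and t1: "0 < t1" "2 * t1 < 1"
    and step: "\<And>t. 0 < t \<Longrightarrow> t \<le> t1 \<Longrightarrow> \<phi> t \<le> \<phi> (2 * t) + K * \<psi> (2 * t)"
    and t: "0 < t" "t < 1"
  shows "\<phi> t \<le> \<phi> t1 + 2 * K * (LINT s:{t<..<1}|lborel. \<psi> s / s)"
proof -
  note int = set_integrable_divide_antimono[OF \<psi> \<psi>0]
  have nonneg: "0 \<le> (LINT s:{t<..<1}|lborel. \<psi> s / s)" if "0 < t" for t
    unfolding set_lebesgue_integral_def
    using that \<psi>0 by (intro integral_nonneg_AE AE_I2) (auto simp: indicator_def)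
  \<comment> \<open>Here k bounds the number of doublings that bring t up to t1. The point t stays
    arbitrary in the induction, since the hypothesis is applied at 2t.\<close>
  have "\<phi> t \<le> \<phi> t1 + 2 * K * (LINT s:{t<..<1}|lborel. \<psi> s / s)"
    if "0 < t" "t < 1" "t1 \<le> t * 2 ^ k" for t k
    using that
  proof (induction k arbitrary: t)
    case 0
    then show ?case using \<phi>[OF t1(1), of t] nonneg[of t] K by (simp add: add_increasing2)
  next
    case (Suc k)
    show ?case
    proof (cases "t1 \<le> t")
      case True
      then show ?thesis using \<phi>[OF t1(1), of t] nonneg[of t] K Suc.prems by (simp add: add_increasing2)
    next
      case False
      then have tt: "0 < 2 * t" "2 * t < 1" using Suc.prems t1 by auto
      have "\<psi> (2 * t) / 2 = (LINT s:{t<..2 * t}|lborel. \<psi> (2 * t) / (2 * t))"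
        using Suc.prems by (simp add: set_lebesgue_integral_def field_simps)
      also have "\<dots> \<le> (LINT s:{t<..2 * t}|lborel. \<psi> s / s)"
      proof (rule set_integral_mono)
        show "\<psi> (2 * t) / (2 * t) \<le> \<psi> s / s" if "s \<in> {t<..2 * t}" for s
          using \<psi>[of s "2 * t"] \<psi>0[of "2 * t"] tt that by (intro frac_le) auto
        show "set_integrable lborel {t<..2 * t} (\<lambda>s. \<psi> (2 * t) / (2 * t))"
          unfolding set_integrable_def using emeasure_bounded_finite[of "{t<..2 * t}"]
          by (intro integrable_scaleR_left integrable_real_indicator) auto
        show "set_integrable lborel {t<..2 * t} (\<lambda>s. \<psi> s / s)"
          using tt Suc.prems by (intro int[where t = t]) auto
      qed
      finally have 1: "\<psi> (2 * t) \<le> 2 * (LINT s:{t<..2 * t}|lborel. \<psi> s / s)" by simp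
      have "{t<..<1} = {t<..2 * t} \<union> {2 * t<..<1}" using tt Suc.prems by auto
      moreover have "(LINT s:{t<..2 * t} \<union> {2 * t<..<1}|lborel. \<psi> s / s) =
          (LINT s:{t<..2 * t}|lborel. \<psi> s / s) + (LINT s:{2 * t<..<1}|lborel. \<psi> s / s)"
        using tt Suc.prems by (intro set_integral_Un int[where t = t]) auto
      ultimately have 2: "(LINT s:{t<..<1}|lborel. \<psi> s / s) =
          (LINT s:{t<..2 * t}|lborel. \<psi> s / s) + (LINT s:{2 * t<..<1}|lborel. \<psi> s / s)" by simp
      have "\<phi> t \<le> \<phi> (2 * t) + K * \<psi> (2 * t)" using step[of t] False Suc.prems by simp
      also have "\<phi> (2 * t) \<le> \<phi> t1 + 2 * K * (LINT s:{2 * t<..<1}|lborel. \<psi> s / s)"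
        using Suc.IH[OF tt] Suc.prems by (simp add: mult.assoc mult.left_commute)
      also have "K * \<psi> (2 * t) \<le> K * (2 * (LINT s:{t<..2 * t}|lborel. \<psi> s / s))"
        using 1 K by (rule mult_left_mono)
      finally show ?thesis unfolding 2 by (simp add: algebra_simps)
    qed
  qed
  moreover obtain k where "t1 / t < 2 ^ k" using real_arch_pow[of 2] by auto
  ultimately show ?thesis using t by (auto simp: field_simps dest: less_imp_le)
qed

section \<open>Functions on (0,1) carried to the cube\<close>

lemma lift01_measurable:
  assumes "\<phi> \<in> borel_measurable (restrict_space lborel {0<..<1})"
  shows "(lift01 \<phi> :: real^'n \<Rightarrow> real) \<in> borel_measurable (lebesgue_on Q0)"
  unfolding lift01_def
proof (rule measurable_compose[OF _ assms])
  let ?i = "SOME i :: 'n. True"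
  have "(\<lambda>x :: real^'n. x $ ?i) \<in> borel_measurable borel"
    by (intro borel_measurable_continuous_onI continuous_intros)
  then have "(\<lambda>x :: real^'n. x $ ?i) \<in> measurable (lebesgue_on Q0) lborel"
    by (intro measurable_restrict_space1 measurable_completion) auto
  then show "(\<lambda>x :: real^'n. x $ ?i) \<in> measurable (lebesgue_on Q0) (restrict_space lborel {0<..<1})"
    by (intro measurable_restrict_space2) (auto simp: mem_Q0)
qed

text \<open>Superlevel sets of \<open>rearr f\<close> are initial intervals of (0,1), whose
  preimages under a coordinate are slabs of the same measure. Rearrangement invariance can thus
  replace f by a function of one coordinate.\<close>

lemma rearr_lift01_rearr:
  fixes f :: "real^'n \<Rightarrow> real"
  assumes f: "f \<in> borel_measurable (lebesgue_on Q0)"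
  shows "rearr (lift01 (rearr f) :: real^'n \<Rightarrow> real) t = rearr f t"
proof -
  let ?i = "SOME i :: 'n. True"
  have "distf (lift01 (rearr f) :: real^'n \<Rightarrow> real) s = distf f s" if s: "0 \<le> s" for s
  proof -
    have "{x \<in> (Q0 :: (real^'n) set). \<bar>lift01 (rearr f) x\<bar> > s} = {x \<in> Q0. x $ ?i < distf f s}"
      using less_rearr_iff[OF f _ s] rearr_nonneg[OF f] by (auto simp: lift01_def mem_Q0)
    then show ?thesis
      using measure_coordinate_slab[of "distf f s" ?i] distf_nonneg[of f s] distf_le_1[OF f, of s] 
      by (simp add: distf_def)
  qed
  then show ?thesis unfolding rearr_def by (intro arg_cong[where f = Inf]) auto
qed

text \<open>Equality holds without the factor 2; losing it spares the continuity of \<open>rearr2 g\<close>.\<close>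
lemma rearr2_le_rearr_lift01:
  fixes g :: "real^'n \<Rightarrow> real"
  assumes g: "integrable (lebesgue_on Q0) g" and s: "0 < s" "2 * s \<le> 1"
  shows "rearr2 g (2 * s) \<le> rearr (lift01 (\<lambda>t. \<bar>rearr2 g t\<bar>) :: real^'n \<Rightarrow> real) s"
    (is "_ \<le> rearr ?h s")
proof (rule ccontr)
  let ?i = "SOME i :: 'n. True"
  assume *: "\<not> ?thesis"
  have hm: "?h \<in> borel_measurable (lebesgue_on Q0)"
    by (intro lift01_measurable borel_measurable_abs borel_measurable_antimono rearr2_antimono[OF g]) auto
  \<comment> \<open>If the bound failed, monotonicity of \<open>rearr2 g\<close> would put a whole
    slab of measure 2s into a superlevel set of measure at most s.\<close>
  have "2 * s = measure lebesgue {x \<in> (Q0 :: (real^'n) set). x $ ?i < 2 * s}"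
    using measure_coordinate_slab[of "2 * s" ?i] s by simp
  also have "\<dots> \<le> distf ?h (rearr ?h s)"
    unfolding distf_def
  proof (intro measure_mono_fmeasurable superlevel_sets[OF hm])
    show "{x \<in> (Q0 :: (real^'n) set). x $ ?i < 2 * s} \<subseteq> {x \<in> Q0. \<bar>?h x\<bar> > rearr ?h s}"
    proof safe
      fix x :: "real^'n" assume x: "x \<in> Q0" "x $ ?i < 2 * s"
      have "rearr2 g (2 * s) \<le> rearr2 g (x $ ?i)"
        using x s by (intro rearr2_antimono[OF g]) (auto simp: mem_Q0)
      then show "rearr ?h s < \<bar>?h x\<bar>" using * by (simp add: lift01_def)
    qed
    have "open {x :: real^'n. x $ ?i < 2 * s}"
      by (intro open_Collect_less continuous_intros)
    then have "open (Q0 \<inter> {x :: real^'n. x $ ?i < 2 * s})" using open_Q0 by blast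
    moreover have "{x \<in> (Q0 :: (real^'n) set). x $ ?i < 2 * s} = Q0 \<inter> {x. x $ ?i < 2 * s}"
      by auto
    ultimately show "{x \<in> (Q0 :: (real^'n) set). x $ ?i < 2 * s} \<in> sets lebesgue"
      by simp
  qed
  also have "\<dots> \<le> s" by (rule distf_rearr_le[OF hm s(1)])
  finally show False using s by simp
qed

text \<open>Chebyshev's inequality in rearranged form; it supplies the value at which the iteration
  over scales ends.\<close>

lemma rearr_le_L1:
  fixes g :: "real^'n \<Rightarrow> real"
  assumes g: "integrable (lebesgue_on Q0) g" and t: "0 < t" "t \<le> 1"
  shows "t * rearr g t \<le> (LINT x|lebesgue_on Q0. \<bar>g x\<bar>)"
proof -
  have gm: "g \<in> borel_measurable (lebesgue_on Q0)" using g by auto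
  have ts: "{0<..<t} \<in> sets (restrict_space lborel {0<..<1})"
    using t by (auto simp: sets_restrict_space_iff)
  have "t * rearr g t \<le> t * rearr2 g t" using rearr_le_rearr2[OF g t] t by simp
  also have "\<dots> \<le> (LINT s|restrict_space lborel {0<..<1}. rearr g s)"
    unfolding rearr2_eq[OF t]
    using integrable_real_mult_indicator[OF ts integrable_rearr[OF g]] integrable_rearr[OF g]
      rearr_nonneg[OF gm]
    by (intro integral_mono) (auto simp: mult.commute indicator_def space_restrict_space)
  also have "\<dots> = (LINT x|lebesgue_on Q0. \<bar>g x\<bar>)"
    using integral_rearr[OF gm, of "\<lambda>u. u"] by simp
  finally show ?thesis .
qed

lemma set_integral_mono_subset:
  fixes f :: "'a \<Rightarrow> real"
  assumes "set_integrable M B f" "A \<in> sets M" "A \<subseteq> B" "\<And>x. x \<in> B \<Longrightarrow> 0 \<le> f x"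
  shows "(LINT x:A|M. f x) \<le> (LINT x:B|M. f x)"
proof -
  have "set_integrable M A f" using assms by (intro set_integrable_subset[OF assms(1)])
  then show ?thesis
    using assms unfolding set_lebesgue_integral_def set_integrable_def
    by (intro integral_mono) (auto split: split_indicator)
qed

text \<open>The role of \<psi> in \<open>iterate_doubling\<close> falls to \<open>rearr g\<close>
  instead of \<open>rearr2 \<gamma>\<close>: the second Boyd condition applies only when the
  integrand is the rearrangement of a function on the cube.\<close>

lemma rearr_le_hardy:
  fixes h \<gamma> :: "real^'n \<Rightarrow> real"
  defines "C \<equiv> (2::real) ^ (CARD('n) + 2)"
    and "g \<equiv> (lift01 (\<lambda>t. \<bar>rearr2 \<gamma> t\<bar>) :: real^'n \<Rightarrow> real)"
  assumes h: "integrable (lebesgue_on Q0) h" and \<gamma>: "integrable (lebesgue_on Q0) \<gamma>"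
    and osc: "\<And>F. F \<in> cube_families \<Longrightarrow> finite F \<Longrightarrow>
      (\<Sum>Q\<in>F. osc_term h Q) \<le> (\<Sum>Q\<in>F. LINT x:Q|lebesgue. \<gamma> x)"
    and t: "0 < t" "t < 1"
  shows "rearr h t \<le> 2 * C * (LINT x|lebesgue_on Q0. \<bar>h x\<bar>)
    + 8 * C * (LINT s:{t<..<1}|lborel. rearr g s / s)"
proof -
  have hm: "h \<in> borel_measurable (lebesgue_on Q0)" using h by auto
  have gm: "g \<in> borel_measurable (lebesgue_on Q0)"
    unfolding g_def
    by (intro lift01_measurable borel_measurable_abs borel_measurable_antimono rearr2_antimono[OF \<gamma>]) auto
  have C: "C \<ge> 4" unfolding C_def by (simp add: power_add)
  \<comment> \<open>The largest t allowed by \<open>rearr_doubling\<close>. Chebyshev at this point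
    costs the factor 1/t1 = 2C.\<close>
  define t1 where "t1 = 1 / (2 * C)"
  have t1: "0 < t1" "2 * t1 < 1" using C by (auto simp: t1_def field_simps)
  have "rearr h t \<le> rearr h t1 + 2 * (4 * C) * (LINT s:{t<..<1}|lborel. rearr g s / s)"
  proof (rule iterate_doubling[OF _ _ _ _ t1 _ t])
    fix u assume u: "0 < u" "u \<le> t1"
    then have Cu: "2 * C * u \<le> 1" using C by (simp add: t1_def field_simps)
    \<comment> \<open>The size of C pays for the factor 2 lost in passing to g:
      \<open>rearr2 \<gamma> (2 * C * u)\<close> is at most \<open>rearr g (C * u)\<close>, hence at
      most \<open>rearr g (2 * u)\<close>, the argument that the iteration requires.\<close>
    have "2 * u \<le> C * u" using C u by (intro mult_right_mono) auto
    then have "rearr2 \<gamma> (2 * (C * u)) \<le> rearr g (2 * u)"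
      using rearr2_le_rearr_lift01[OF \<gamma>, of "C * u"] rearr_antimono[OF gm, of "2 * u" "C * u"] u C Cu
      by (simp add: g_def mult.assoc)
    then have "4 * C * rearr2 \<gamma> (2 * C * u) \<le> 4 * C * rearr g (2 * u)"
      using C by (intro mult_left_mono) (auto simp: mult.assoc)
    moreover have "rearr h u \<le> rearr h (2 * u) + 4 * C * rearr2 \<gamma> (2 * C * u)"
      using rearr_doubling[OF h \<gamma> osc u(1)] Cu by (simp add: C_def)
    ultimately show "rearr h u \<le> rearr h (2 * u) + 4 * C * rearr g (2 * u)" by linarith
  qed (use rearr_antimono[OF hm] rearr_antimono[OF gm] rearr_nonneg[OF gm] C in auto)
  moreover have "rearr h t1 \<le> 2 * C * (LINT x|lebesgue_on Q0. \<bar>h x\<bar>)"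
    using rearr_le_L1[OF h t1(1)] t1 C by (simp add: t1_def field_simps)
  ultimately show ?thesis by simp
qed

section \<open>Norm estimates\<close>

context
  fixes \<rho> :: "(real^'n \<Rightarrow> real) \<Rightarrow> ennreal"
  assumes \<rho>: "bf_norm \<rho>"
begin

lemma bf_norm_scale:
  assumes "nnmeas f" "0 \<le> a"
  shows "\<rho> (\<lambda>x. a * f x) = ennreal a * \<rho> f"
proof -
  have "\<forall>f a. nnmeas f \<and> 0 \<le> a \<longrightarrow> \<rho> (\<lambda>x. a * f x) = ennreal a * \<rho> f"
    using \<rho> unfolding bf_norm_def by (elim conjE)
  then show ?thesis using assms by simp
qed

lemma bf_norm_add:
  assumes "nnmeas f" "nnmeas g"
  shows "\<rho> (\<lambda>x. f x + g x) \<le> \<rho> f + \<rho> g"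
proof -
  have "\<forall>f g. nnmeas f \<and> nnmeas g \<longrightarrow> \<rho> (\<lambda>x. f x + g x) \<le> \<rho> f + \<rho> g"
    using \<rho> unfolding bf_norm_def by (elim conjE)
  then show ?thesis using assms by simp
qed

lemma bf_norm_mono:
  assumes "nnmeas f" "nnmeas g" "\<And>x. x \<in> Q0 \<Longrightarrow> g x \<le> f x"
  shows "\<rho> g \<le> \<rho> f"
proof -
  have "\<forall>f g. nnmeas f \<and> nnmeas g \<and> (AE x in lebesgue_on Q0. g x \<le> f x) \<longrightarrow> \<rho> g \<le> \<rho> f"
    using \<rho> unfolding bf_norm_def by (elim conjE)
  moreover have "AE x in lebesgue_on Q0. g x \<le> f x" using assms(3) by (intro AE_I2) simp
  ultimately show ?thesis using assms(1,2) by simp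
qed

lemma nnmeas_one: "nnmeas (\<lambda>x. 1)"
  by (simp add: nnmeas_def)

lemma bf_norm_one: "\<rho> (\<lambda>x. 1) < \<infinity>"
proof -
  have "nnmeas (indicator Q0 :: real^'n \<Rightarrow> real)"
    unfolding nnmeas_def
    by (intro conjI measurable_restrict_space1 borel_measurable_indicator Q0_sets) auto
  then have "\<rho> (\<lambda>x. 1) \<le> \<rho> (indicator Q0)"
    by (rule bf_norm_mono[OF _ nnmeas_one]) simp
  also have "\<dots> < \<infinity>"
  proof -
    have "\<forall>E. E \<in> sets lebesgue \<and> E \<subseteq> Q0 \<longrightarrow> \<rho> (indicator E) < \<infinity>"
      using \<rho> unfolding bf_norm_def by (elim conjE)
    then show ?thesis by simp
  qed
  finally show ?thesis .
qed

lemma bf_norm_L1: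
  obtains c where "c \<ge> 0"
    "\<And>f. nnmeas f \<Longrightarrow> (\<integral>\<^sup>+x. ennreal (f x) \<partial>lebesgue_on Q0) \<le> ennreal c * \<rho> f"
proof -
  obtain c :: real where c: "\<And>f. nnmeas f \<Longrightarrow> (\<integral>\<^sup>+x\<in>Q0. ennreal (f x) \<partial>lebesgue) \<le> ennreal c * \<rho> f"
  proof -
    have "\<forall>E. E \<in> sets lebesgue \<and> E \<subseteq> Q0 \<longrightarrow>
        (\<exists>C::real. \<forall>f. nnmeas f \<longrightarrow> (\<integral>\<^sup>+x\<in>E. ennreal (f x) \<partial>lebesgue) \<le> ennreal C * \<rho> f)"
      using \<rho> unfolding bf_norm_def by (elim conjE)
    from this[rule_format, OF conjI[OF Q0_sets order_refl]] show ?thesis using that by blast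
  qed
  have "(\<integral>\<^sup>+x. ennreal (f x) \<partial>lebesgue_on Q0) \<le> ennreal (max 0 c) * \<rho> f" if "nnmeas f" for f
  proof -
    \<comment> \<open>The constant in \<open>bf_norm\<close> is an arbitrary real;
      \<open>ennreal\<close> sends a negative one to 0.\<close>
    have "ennreal (max 0 c) = ennreal c" by (simp add: max_def ennreal_neg)
    then show ?thesis using c[OF that] by (simp add: nn_integral_restrict_space)
  qed
  then show ?thesis by (intro that[of "max 0 c"]) auto
qed

section \<open>Embedding of X in L1 and inclusion of X in GaRo\<close>

lemma nnmeas_abs: "f \<in> borel_measurable (lebesgue_on Q0) \<Longrightarrow> nnmeas (\<lambda>x. \<bar>f x\<bar>)"
  by (simp add: nnmeas_def)

lemma Xsp_integrable:
  assumes "f \<in> Xsp \<rho>"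
  shows "integrable (lebesgue_on Q0) f"
proof (rule integrableI_bounded)
  show fm: "f \<in> borel_measurable (lebesgue_on Q0)" using assms by (simp add: Xsp_def)
  obtain c where "c \<ge> 0" and
    c: "\<And>f. nnmeas f \<Longrightarrow> (\<integral>\<^sup>+x. ennreal (f x) \<partial>lebesgue_on Q0) \<le> ennreal c * \<rho> f"
    using bf_norm_L1 by blast
  have "(\<integral>\<^sup>+x. ennreal (norm (f x)) \<partial>lebesgue_on Q0) \<le> ennreal c * \<rho> (\<lambda>x. \<bar>f x\<bar>)"
    using c[OF nnmeas_abs[OF fm]] by simp
  also have "\<dots> < \<infinity>" using assms by (auto simp: Xsp_def ennreal_mult_less_top)
  finally show "(\<integral>\<^sup>+x. ennreal (norm (f x)) \<partial>lebesgue_on Q0) < \<infinity>" .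
qed

lemma two_abs_in_Gamma:
  assumes f: "f \<in> Xsp \<rho>"
  shows "(\<lambda>x. 2 * \<bar>f x\<bar>) \<in> Gamma \<rho> f" "xnorm \<rho> (\<lambda>x. 2 * \<bar>f x\<bar>) = 2 * xnorm \<rho> f"
proof -
  have fi: "integrable (lebesgue_on Q0) f" by (rule Xsp_integrable[OF f])
  have fm: "f \<in> borel_measurable (lebesgue_on Q0)" using fi by auto
  have \<rho>2: "\<rho> (\<lambda>x. \<bar>2 * \<bar>f x\<bar>\<bar>) = 2 * \<rho> (\<lambda>x. \<bar>f x\<bar>)"
    using bf_norm_scale[OF nnmeas_abs[OF fm], of 2] by (simp add: abs_mult)
  then show "xnorm \<rho> (\<lambda>x. 2 * \<bar>f x\<bar>) = 2 * xnorm \<rho> f"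
    by (simp add: xnorm_def enn2real_mult)
  have X: "(\<lambda>x. 2 * \<bar>f x\<bar>) \<in> Xsp \<rho>"
    using f fm unfolding Xsp_def mem_Collect_eq \<rho>2 by (auto simp: ennreal_mult_less_top)
  have "osc_term f summable_on F \<and>
       (\<Sum>\<^sub>\<infinity>Q\<in>F. osc_term f Q) \<le> (\<Sum>\<^sub>\<infinity>Q\<in>F. LINT x:Q|lebesgue. 2 * \<bar>f x\<bar>)"
    if F: "F \<in> cube_families" for F
  proof -
    have cube: "is_cube Q" if "Q \<in> F" for Q using F that by (auto simp: cube_families_def)
    have int2: "integrable (lebesgue_on Q0) (\<lambda>x. 2 * \<bar>f x\<bar>)" using fi by auto
    have intQ: "set_integrable lebesgue Q (\<lambda>x. 2 * \<bar>f x\<bar>)" if "Q \<in> F" for Q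
      using set_integrable_lebesgue_on(1)[OF int2 fmeasurableD[OF is_cube_lmeasurable[OF cube[OF that]]]
          is_cube_subset[OF cube[OF that]]] by simp
    let ?s = "\<lambda>Q. LINT x:Q|lebesgue. 2 * \<bar>f x\<bar>"
    have s0: "0 \<le> ?s Q" for Q
      unfolding set_lebesgue_integral_def by (intro Bochner_Integration.integral_nonneg) auto
    have os: "osc_term f Q \<le> ?s Q" if "Q \<in> F" for Q
      using osc_term_le[OF fi cube[OF that]] by simp
    \<comment> \<open>\<open>infsum\<close> defaults to 0 on families that are not summable, so both
      families must be summable before the sums are compared. The partial sums are integrals over
      disjoint unions of cubes, bounded by the integral over \<open>Q0\<close>.\<close>
    have sum: "?s summable_on F"
    proof (rule nonneg_bdd_above_summable_on[OF s0])
      show "bdd_above (sum ?s ` {F'. F' \<subseteq> F \<and> finite F'})"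
      proof (rule bdd_aboveI2)
        fix F' assume "F' \<in> {F'. F' \<subseteq> F \<and> finite F'}"
        then have F': "F' \<subseteq> F" "finite F'" by auto
        have "sum ?s F' = (LINT x:(\<Union>Q\<in>F'. Q)|lebesgue. 2 * \<bar>f x\<bar>)"
        proof (rule set_integral_finite_Union[symmetric, OF F'(2)])
          show "disjoint_family_on (\<lambda>Q. Q) F'"
            using F F' unfolding disjoint_family_on_def cube_families_def by blast
          show "set_integrable lebesgue Q (\<lambda>x. 2 * \<bar>f x\<bar>)" "Q \<in> sets lebesgue" if "Q \<in> F'" for Q
            using F' that intQ cube by (auto intro!: fmeasurableD is_cube_lmeasurable)
        qed
        also have "\<dots> \<le> (LINT x:Q0|lebesgue. 2 * \<bar>f x\<bar>)"
        proof (rule set_integral_mono_subset)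
          show "set_integrable lebesgue Q0 (\<lambda>x. 2 * \<bar>f x\<bar>)"
            using set_integrable_lebesgue_on(1)[OF int2 Q0_sets] by simp
          show "(\<Union>Q\<in>F'. Q) \<in> sets lebesgue"
            using F' cube by (intro sets.finite_UN) (auto intro!: fmeasurableD is_cube_lmeasurable)
          show "(\<Union>Q\<in>F'. Q) \<subseteq> Q0" using F' cube is_cube_subset by blast
        qed simp
        finally show "sum ?s F' \<le> (LINT x:Q0|lebesgue. 2 * \<bar>f x\<bar>)" .
      qed
    qed
    have "osc_term f summable_on F"
      by (rule summable_on_comparison_test[OF sum])
         (use os osc_term_nonneg[OF fi cube] in auto)
    then show ?thesis using sum os by (auto intro!: infsum_mono)
  qed
  then show "(\<lambda>x. 2 * \<bar>f x\<bar>) \<in> Gamma \<rho> f" using X by (auto simp: Gamma_def)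
qed

end

section \<open>The norm of X bounded by admissible functions\<close>

lemma Gamma_shift: "Gamma \<rho> (\<lambda>x. f x - c) = Gamma \<rho> f"
  by (simp add: Gamma_def osc_term_shift)

lemma rearr_abs: "rearr (\<lambda>x. \<bar>f x\<bar>) = rearr f"
  by (simp add: fun_eq_iff rearr_def distf_def)

text \<open>Stated for \<open>\<rho>\<close> itself, before \<open>enn2real\<close>: finiteness of
  the left side is then a conclusion, which gives the inclusion of \<open>GaRo\<close> in
  \<open>Xsp\<close>. The constant is fixed before f and \<gamma>.\<close>

lemma rho_le_Gamma:
  fixes \<rho> :: "(real^'n \<Rightarrow> real) \<Rightarrow> ennreal"
  assumes ri: "ri_space \<rho>" and boyd: "boyd_in_01 \<rho>"
  obtains c where "c \<ge> 0"
    "\<And>f \<gamma>. integrable (lebesgue_on Q0) f \<Longrightarrow> \<gamma> \<in> Gamma \<rho> f \<Longrightarrow>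
      \<rho> (\<lambda>x. \<bar>f x - avg Q0 f\<bar>) \<le> ennreal c * \<rho> (\<lambda>x. \<bar>\<gamma> x\<bar>)"
proof -
  have bf: "bf_norm \<rho>" using ri by (simp add: ri_space_def)
  obtain b0 b1 :: real where b: "\<And>f. f \<in> Xsp \<rho> \<Longrightarrow>
       \<rho> (lift01 (\<lambda>t. \<bar>rearr2 f t\<bar>)) \<le> ennreal b0 * \<rho> (\<lambda>x. \<bar>f x\<bar>)"
     "\<And>f. f \<in> Xsp \<rho> \<Longrightarrow>
       \<rho> (lift01 (\<lambda>t. \<bar>LINT s:{t<..<1}|lborel. rearr f s / s\<bar>)) \<le> ennreal b1 * \<rho> (\<lambda>x. \<bar>f x\<bar>)"
    using boyd unfolding boyd_in_01_def by blast
  obtain c1 where c1: "c1 \<ge> 0"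
    "\<And>f. nnmeas f \<Longrightarrow> (\<integral>\<^sup>+x. ennreal (f x) \<partial>lebesgue_on Q0) \<le> ennreal c1 * \<rho> f"
    using bf_norm_L1[OF bf] by blast
  define C where "C = (2::real) ^ (CARD('n) + 2)"
  define r1 where "r1 = enn2real (\<rho> (\<lambda>x. 1))"
  have r1: "\<rho> (\<lambda>x. 1) = ennreal r1" using bf_norm_one[OF bf] by (simp add: r1_def)
  have C: "C > 0" by (simp add: C_def)
  \<comment> \<open>The Boyd constants may be negative reals; truncation at 0 agrees with
    \<open>ennreal\<close>.\<close>
  define B where "B = max 0 b1 * max 0 b0"
  have B: "ennreal b1 * ennreal b0 = ennreal B" "B \<ge> 0"
    by (auto simp: B_def max_def ennreal_neg ennreal_mult)
  \<comment> \<open>One summand for each term of \<open>rearr_le_hardy\<close>: a constant function,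
    costing the L1 embedding constant c1 and the norm r1 of 1, and the integral, costing both Boyd
    constants.\<close>
  define c where "c = 2 * C * c1 * r1 + 8 * C * B"
  have c0: "c \<ge> 0" using C c1 B by (simp add: c_def r1_def)
  have "\<rho> (\<lambda>x. \<bar>f x - avg Q0 f\<bar>) \<le> ennreal c * \<rho> (\<lambda>x. \<bar>\<gamma> x\<bar>)"
    if f: "integrable (lebesgue_on Q0) f" and "\<gamma> \<in> Gamma \<rho> f" for f \<gamma>
  proof -
    interpret M: finite_measure "lebesgue_on Q0 :: (real^'n) measure"
      by (rule finite_measure_lebesgue_on) simp
    define h where "h = (\<lambda>x. f x - avg Q0 f)"
    have \<gamma>G: "\<gamma> \<in> Gamma \<rho> h" using that by (simp add: h_def Gamma_shift)
    then have \<gamma>X: "\<gamma> \<in> Xsp \<rho>" by (simp add: Gamma_def)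
    have \<gamma>: "integrable (lebesgue_on Q0) \<gamma>" by (rule Xsp_integrable[OF bf \<gamma>X])
    have \<gamma>m: "\<gamma> \<in> borel_measurable (lebesgue_on Q0)" using \<gamma> by auto
    have h: "integrable (lebesgue_on Q0) h" using f by (simp add: h_def)
    have hm: "h \<in> borel_measurable (lebesgue_on Q0)" using h by auto
    have osc: "(\<Sum>Q\<in>F. osc_term h Q) \<le> (\<Sum>Q\<in>F. LINT x:Q|lebesgue. \<gamma> x)"
      if F: "F \<in> cube_families" "finite F" for F
    proof -
      have "(\<Sum>\<^sub>\<infinity>Q\<in>F. osc_term h Q) \<le> (\<Sum>\<^sub>\<infinity>Q\<in>F. LINT x:Q|lebesgue. \<gamma> x)"
        using \<gamma>G F(1) by (simp add: Gamma_def)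
      then show ?thesis using F(2) by simp
    qed
    define A where "A = (LINT x|lebesgue_on Q0. \<bar>h x\<bar>)"
    have "A \<le> osc_term h Q0"
      using L1_dist_avg_le_osc[OF f] by (simp add: A_def h_def osc_term_shift)
    also have "\<dots> \<le> (LINT x:Q0|lebesgue. \<gamma> x)"
      using osc[OF Q0_family] by simp
    also have "\<dots> \<le> (LINT x|lebesgue_on Q0. \<bar>\<gamma> x\<bar>)"
      using \<gamma> by (simp add: set_integral_lebesgue_on_self) (intro integral_mono, auto)
    finally have "ennreal A \<le> ennreal (LINT x|lebesgue_on Q0. \<bar>\<gamma> x\<bar>)" by (rule ennreal_leI)
    also have "\<dots> = (\<integral>\<^sup>+x. ennreal \<bar>\<gamma> x\<bar> \<partial>lebesgue_on Q0)"
      using \<gamma> by (intro nn_integral_eq_integral[symmetric]) auto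
    also have "\<dots> \<le> ennreal c1 * \<rho> (\<lambda>x. \<bar>\<gamma> x\<bar>)"
      by (rule c1(2)[OF nnmeas_abs[OF bf \<gamma>m]])
    finally have A: "ennreal A \<le> ennreal c1 * \<rho> (\<lambda>x. \<bar>\<gamma> x\<bar>)" .
    have A0: "A \<ge> 0" by (simp add: A_def)
    define g where "g = (lift01 (\<lambda>t. \<bar>rearr2 \<gamma> t\<bar>) :: real^'n \<Rightarrow> real)"
    have gm: "g \<in> borel_measurable (lebesgue_on Q0)"
      unfolding g_def
      by (intro lift01_measurable borel_measurable_abs borel_measurable_antimono rearr2_antimono[OF \<gamma>]) auto
    have gabs: "(\<lambda>x. \<bar>g x\<bar>) = g" by (auto simp: g_def lift01_def)
    \<comment> \<open>The first Boyd condition not only bounds g but places it in X, as the second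
      condition demands of its argument.\<close>
    have g\<rho>: "\<rho> g \<le> ennreal b0 * \<rho> (\<lambda>x. \<bar>\<gamma> x\<bar>)" unfolding g_def by (rule b(1)[OF \<gamma>X])
    also have "\<dots> < \<infinity>" using \<gamma>X by (auto simp: Xsp_def ennreal_mult_less_top)
    finally have gX: "g \<in> Xsp \<rho>" using gm gabs by (simp add: Xsp_def)
    define H where "H = (\<lambda>t. LINT s:{t<..<1}|lborel. rearr g s / s)"
    have H0: "0 \<le> H t" if "0 < t" for t
      unfolding H_def set_lebesgue_integral_def
      using that rearr_nonneg[OF gm]
      by (intro Bochner_Integration.integral_nonneg) (auto simp: indicator_def)
    have Hb: "rearr h t \<le> 2 * C * A + 8 * C * H t" if "0 < t" "t < 1" for t
      unfolding C_def A_def H_def g_def by (rule rearr_le_hardy[OF h \<gamma> osc that])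
    have Hm: "(\<lambda>t. \<bar>H t\<bar>) \<in> borel_measurable (restrict_space lborel {0<..<1})"
    proof (intro borel_measurable_abs borel_measurable_antimono)
      fix s t :: real assume st: "0 < s" "s \<le> t" "t < 1"
      show "H t \<le> H s"
        unfolding H_def
      proof (rule set_integral_mono_subset)
        show "set_integrable lborel {s<..<1} (\<lambda>u. rearr g u / u)"
          using rearr_antimono[OF gm] rearr_nonneg[OF gm] st
          by (intro set_integrable_divide_antimono[where t = s]) auto
      qed (use st rearr_nonneg[OF gm] in auto)
    qed
    define W where "W = (lift01 (\<lambda>t. \<bar>H t\<bar>) :: real^'n \<Rightarrow> real)"
    have W: "nnmeas W" using lift01_measurable[OF Hm] by (auto simp: nnmeas_def W_def lift01_def)
    have W\<rho>: "\<rho> W \<le> ennreal b1 * \<rho> g"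
      using b(2)[OF gX] by (simp add: W_def H_def gabs)
    define V where "V = (lift01 (rearr h) :: real^'n \<Rightarrow> real)"
    have V: "nnmeas V"
      using lift01_measurable[OF rearr_borel[OF hm]] rearr_nonneg[OF hm]
      by (auto simp: nnmeas_def V_def) (auto simp: lift01_def mem_Q0)
    \<comment> \<open>V and W depend on the same coordinate, so after this replacement
      \<open>Hb\<close>, taken at that coordinate, becomes a pointwise bound on the cube and the
      lattice property of the norm applies.\<close>
    have "\<rho> (\<lambda>x. \<bar>h x\<bar>) = \<rho> V"
      using ri V nnmeas_abs[OF bf hm] rearr_lift01_rearr[OF hm] unfolding ri_space_def V_def rearr_abs
      by (metis rearr_abs)
    also have "\<dots> \<le> \<rho> (\<lambda>x. 2 * C * A * 1 + 8 * C * W x)"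
    proof (rule bf_norm_mono[OF bf _ V])
      show "nnmeas (\<lambda>x. 2 * C * A * 1 + 8 * C * W x)"
        using W C A0 by (auto simp: nnmeas_def)
      show "V x \<le> 2 * C * A * 1 + 8 * C * W x" if "x \<in> Q0" for x
        using that Hb H0 C by (simp add: V_def W_def lift01_def mem_Q0 abs_of_nonneg)
    qed
    also have "\<dots> \<le> \<rho> (\<lambda>x. 2 * C * A * 1) + \<rho> (\<lambda>x. 8 * C * W x)"
      using W C A0 by (intro bf_norm_add[OF bf]) (auto simp: nnmeas_def)
    also have "\<dots> = ennreal (2 * C * A) * \<rho> (\<lambda>x. 1) + ennreal (8 * C) * \<rho> W"
    proof (rule arg_cong2[where f = "(+)"])
      show "\<rho> (\<lambda>x. 2 * C * A * 1) = ennreal (2 * C * A) * \<rho> (\<lambda>x. 1)"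
        by (rule bf_norm_scale[OF bf nnmeas_one[OF bf]]) (use C A0 in auto)
      show "\<rho> (\<lambda>x. 8 * C * W x) = ennreal (8 * C) * \<rho> W"
        by (rule bf_norm_scale[OF bf W]) (use C in auto)
    qed
    also have "\<dots> \<le> ennreal (2 * C * c1 * r1) * \<rho> (\<lambda>x. \<bar>\<gamma> x\<bar>) + ennreal (8 * C * B) * \<rho> (\<lambda>x. \<bar>\<gamma> x\<bar>)"
    proof (rule add_mono)
      have "ennreal (2 * C * A) * \<rho> (\<lambda>x. 1) = ennreal (2 * C * r1) * ennreal A"
        unfolding r1 using C A0 by (simp add: ennreal_mult[symmetric] r1_def mult_ac)
      also have "\<dots> \<le> ennreal (2 * C * r1) * (ennreal c1 * \<rho> (\<lambda>x. \<bar>\<gamma> x\<bar>))"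
        using A by (rule mult_left_mono) simp
      also have "\<dots> = ennreal (2 * C * c1 * r1) * \<rho> (\<lambda>x. \<bar>\<gamma> x\<bar>)"
        using C c1 by (simp add: mult.assoc[symmetric] ennreal_mult[symmetric] r1_def) (simp add: mult_ac)
      finally show "ennreal (2 * C * A) * \<rho> (\<lambda>x. 1) \<le> ennreal (2 * C * c1 * r1) * \<rho> (\<lambda>x. \<bar>\<gamma> x\<bar>)" .
      have "\<rho> W \<le> ennreal b1 * (ennreal b0 * \<rho> (\<lambda>x. \<bar>\<gamma> x\<bar>))"
        using W\<rho> mult_left_mono[OF g\<rho>, of "ennreal b1"] by (auto intro: order_trans)
      also have "\<dots> = ennreal B * \<rho> (\<lambda>x. \<bar>\<gamma> x\<bar>)" by (simp add: mult.assoc[symmetric] B)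
      finally have "ennreal (8 * C) * \<rho> W \<le> ennreal (8 * C) * (ennreal B * \<rho> (\<lambda>x. \<bar>\<gamma> x\<bar>))"
        by (rule mult_left_mono) simp
      then show "ennreal (8 * C) * \<rho> W \<le> ennreal (8 * C * B) * \<rho> (\<lambda>x. \<bar>\<gamma> x\<bar>)"
        using C B by (simp add: ennreal_mult mult.assoc)
    qed
    also have "\<dots> = ennreal c * \<rho> (\<lambda>x. \<bar>\<gamma> x\<bar>)"
      using C c1 B by (simp add: c_def r1_def distrib_right)
    finally show ?thesis by (simp add: h_def)
  qed
  then show ?thesis using c0 by (intro that[of c])
qed

theorem theorem3p2:
  fixes \<rho> :: "(real^'n \<Rightarrow> real) \<Rightarrow> ennreal"
  assumes "ri_space \<rho>" and "boyd_in_01 \<rho>"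
  shows "GaRo \<rho> = Xsp \<rho> \<and>
    (\<forall>f\<in>Xsp \<rho>. garo_norm \<rho> (\<lambda>x. f x - avg Q0 f) \<le> 2 * xnorm \<rho> f) \<and>
    (\<exists>c::real. \<forall>f\<in>GaRo \<rho>. xnorm \<rho> (\<lambda>x. f x - avg Q0 f) \<le> c * garo_norm \<rho> f)"
proof -
  have bf: "bf_norm \<rho>" using assms(1) by (simp add: ri_space_def)
  obtain c where c: "c \<ge> 0"
    "\<And>f \<gamma>. integrable (lebesgue_on Q0) f \<Longrightarrow> \<gamma> \<in> Gamma \<rho> f \<Longrightarrow>
      \<rho> (\<lambda>x. \<bar>f x - avg Q0 f\<bar>) \<le> ennreal c * \<rho> (\<lambda>x. \<bar>\<gamma> x\<bar>)"
    using rho_le_Gamma[OF assms] by blast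
  have xn: "xnorm \<rho> (\<lambda>x. f x - avg Q0 f) \<le> c * xnorm \<rho> \<gamma>"
    if "integrable (lebesgue_on Q0) f" "\<gamma> \<in> Gamma \<rho> f" for f \<gamma>
  proof -
    \<comment> \<open>\<open>enn2real\<close> maps infinity to 0 and is monotone only below it, so
      the right side must be finite.\<close>
    have "\<rho> (\<lambda>x. \<bar>\<gamma> x\<bar>) < \<infinity>" using that by (simp add: Gamma_def Xsp_def)
    then have "ennreal c * \<rho> (\<lambda>x. \<bar>\<gamma> x\<bar>) < top" by (auto simp: ennreal_mult_less_top)
    from enn2real_mono[OF c(2)[OF that] this] show ?thesis
      using c(1) by (simp add: xnorm_def enn2real_mult)
  qed
  have "f \<in> Xsp \<rho>" if f: "f \<in> GaRo \<rho>" for f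
  proof -
    obtain \<gamma> where fi: "integrable (lebesgue_on Q0) f" and \<gamma>: "\<gamma> \<in> Gamma \<rho> f"
      using f unfolding GaRo_def by blast
    have fm: "f \<in> borel_measurable (lebesgue_on Q0)" using fi by auto
    have hm: "(\<lambda>x. f x - avg Q0 f) \<in> borel_measurable (lebesgue_on Q0)" using fm by auto
    have const: "nnmeas (\<lambda>x :: real^'n. \<bar>avg Q0 f\<bar> * 1)" by (simp add: nnmeas_def)
    \<comment> \<open>The average is a real number and constants belong to X, so adding it back
      keeps f in X.\<close>
    have "\<rho> (\<lambda>x. \<bar>f x\<bar>) \<le> \<rho> (\<lambda>x. \<bar>f x - avg Q0 f\<bar> + \<bar>avg Q0 f\<bar> * 1)"
      using nnmeas_abs[OF bf fm] nnmeas_abs[OF bf hm]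
      by (intro bf_norm_mono[OF bf]) (auto simp: nnmeas_def)
    also have "\<dots> \<le> \<rho> (\<lambda>x. \<bar>f x - avg Q0 f\<bar>) + \<rho> (\<lambda>x. \<bar>avg Q0 f\<bar> * 1)"
      by (rule bf_norm_add[OF bf nnmeas_abs[OF bf hm] const])
    also have "\<dots> \<le> ennreal c * \<rho> (\<lambda>x. \<bar>\<gamma> x\<bar>) + ennreal \<bar>avg Q0 f\<bar> * \<rho> (\<lambda>x. 1)"
      using c(2)[OF fi \<gamma>] bf_norm_scale[OF bf nnmeas_one[OF bf], of "\<bar>avg Q0 f\<bar>"]
      by (intro add_mono) auto
    also have "\<dots> < \<infinity>"
      using \<gamma> bf_norm_one[OF bf] by (auto simp: Gamma_def Xsp_def ennreal_mult_less_top)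
    finally show ?thesis using fm by (simp add: Xsp_def)
  qed
  moreover have "f \<in> GaRo \<rho>" if "f \<in> Xsp \<rho>" for f
    using two_abs_in_Gamma(1)[OF bf that] Xsp_integrable[OF bf that] by (auto simp: GaRo_def)
  moreover have "garo_norm \<rho> (\<lambda>x. f x - avg Q0 f) \<le> 2 * xnorm \<rho> f" if "f \<in> Xsp \<rho>" for f
  proof -
    have "garo_norm \<rho> (\<lambda>x. f x - avg Q0 f) \<le> xnorm \<rho> (\<lambda>x. 2 * \<bar>f x\<bar>)"
      unfolding garo_norm_def Gamma_shift
      by (intro cINF_lower two_abs_in_Gamma(1)[OF bf that] bdd_belowI2[of _ 0]) (simp add: xnorm_def)
    then show ?thesis by (simp add: two_abs_in_Gamma(2)[OF bf that])
  qed
  \<comment> \<open>Since c may be 0, c + 1 is used: dividing by it lets the bound pass to the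
    infimum over \<open>Gamma\<close>, which is nonempty for f in \<open>GaRo\<close>.\<close>
  moreover have "xnorm \<rho> (\<lambda>x. f x - avg Q0 f) \<le> (c + 1) * garo_norm \<rho> f" if "f \<in> GaRo \<rho>" for f
  proof -
    have fi: "integrable (lebesgue_on Q0) f" and ne: "Gamma \<rho> f \<noteq> {}"
      using that by (auto simp: GaRo_def)
    have "xnorm \<rho> (\<lambda>x. f x - avg Q0 f) / (c + 1) \<le> garo_norm \<rho> f"
      unfolding garo_norm_def
    proof (rule cINF_greatest[OF ne])
      fix \<gamma> assume "\<gamma> \<in> Gamma \<rho> f"
      then have "xnorm \<rho> (\<lambda>x. f x - avg Q0 f) \<le> c * xnorm \<rho> \<gamma>" by (rule xn[OF fi])
      also have "\<dots> \<le> (c + 1) * xnorm \<rho> \<gamma>" by (simp add: xnorm_def mult_right_mono)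
      finally show "xnorm \<rho> (\<lambda>x. f x - avg Q0 f) / (c + 1) \<le> xnorm \<rho> \<gamma>"
        using c(1) by (simp add: field_simps)
    qed
    then show ?thesis using c(1) by (simp add: field_simps)
  qed
  ultimately show ?thesis by blast
qed

end
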